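(* For any persistent space $X_\bullet:(\mathbb{R},\leq)\to\mathrm{Top}$ and every closed interval $[a,b]$ with $a\leq b$ in $\mathbb{R}$, $$\mathbf{cup}(X_\bullet)([a,b])\leq\mathbf{cat}(X_\bullet)([a,b]).$$
   Context: $\mathrm{Top}$ is the category of compactly generated weak Hausdorff spaces. A persistent space is a functor $X_\bullet:(\mathbb{R},\leq)\to\mathrm{Top}$ with transition maps $f_a^b:X_a\to X_b$, $a\leq b$. Cohomology is over a fixed field $K$ and $\mathbf{H}^*(X)$ is the graded cohomology ring under cup product. Persistent cup-length: for a graded ring $R$, $\mathbf{len}(R)$ is the largest $\ell\geq0$ such that some product of $\ell$ homogeneous positive-degree elements is nonzero ($0$ if there are no nonzero positive-degree elements, $\infty$ if no largest exists). $\mathbf{cup}(X_\bullet)([a,b])=\mathbf{len}(\mathrm{im}(\mathbf{H}^*(f_a^b):\mathbf{H}^*(X_b)\to\mathbf{H}^*(X_a)))$. Persistent LS-category: for a continuous map $f:X\to Y$, $\mathbf{cat}(f)$ is the least $n\in\mathbb{N}$ (or $+\infty$ if none) such that $X$ can be covered by open sets $U_1,\dots,U_{n+1}$ with each $f|_{U_i}:U_i\to Y$ homotopic to a constant map (maps from the empty set count as null-homotopic). $\mathbf{cat}(X_\bullet)([a,b])=\mathbf{cat}(f_a^b)$. *)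

theory Defs
  imports "HOL-Analysis.Analysis" "HOL-Homology.Homology" "HOL-Algebra.QuotRing" "HOL-Library.Extended_Nat"
begin

section \<open>Compactly generated weak Hausdorff spaces\<close>

text \<open>
  Both notions quantify over all continuous maps from compact Hausdorff spaces. HOL cannot quantify
  over types inside a definition, so the test spaces carry topologies on the fixed type
  \<^typ>\<open>'a set set\<close>, where \<^typ>\<open>'a\<close> is the point type of the space. This is no restriction:
  \<open>weak_hausdorff_space_test\<close> and \<open>compactly_generated_space_test\<close> below show that test spaces over
  an arbitrary type impose nothing more. (The predicate \<^const>\<open>k_space\<close> of the library is a different
  notion, as it tests with all compact subspaces, whether Hausdorff or not.)
\<close>

definition weak_hausdorff_space :: "'a topology \<Rightarrow> bool" where
  "weak_hausdorff_space X \<longleftrightarrow>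
    (\<forall>(T :: 'a set set topology) u.
       compact_space T \<and> Hausdorff_space T \<and> continuous_map T X u \<longrightarrow> closedin X (u ` topspace T))"

definition compactly_generated_space :: "'a topology \<Rightarrow> bool" where
  "compactly_generated_space X \<longleftrightarrow>
    (\<forall>A \<subseteq> topspace X.
       (\<forall>(T :: 'a set set topology) u.
          compact_space T \<and> Hausdorff_space T \<and> continuous_map T X u
            \<longrightarrow> closedin T {t \<in> topspace T. u t \<in> A})
       \<longrightarrow> closedin X A)"

definition CGWH_space :: "'a topology \<Rightarrow> bool" where
  "CGWH_space X \<longleftrightarrow> compactly_generated_space X \<and> weak_hausdorff_space X"

lemma ex_homeomorphic_copy:
  fixes T :: "'t topology" and i :: "'t \<Rightarrow> 's"
  assumes "inj_on i (topspace T)"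
  obtains S :: "'s topology" and j where "homeomorphic_maps T S i j"
proof -
  define j where "j = inv_into (topspace T) i"
  define S where "S = pullback_topology (i ` topspace T) j T"
  have ji: "j (i t) = t" if "t \<in> topspace T" for t
    using assms that by (simp add: j_def)
  have top: "topspace S = i ` topspace T"
    using ji by (auto simp: S_def topspace_pullback_topology)
  have 1: "continuous_map S T j"
    using continuous_map_pullback[OF continuous_map_id[of T], of "i ` topspace T" j]
    by (simp add: S_def)
  have "continuous_map T T (j \<circ> i)"
    by (rule continuous_map_eq[OF continuous_map_id]) (simp add: ji)
  then have 2: "continuous_map T S i"
    unfolding S_def by (rule continuous_map_pullback') auto
  have "homeomorphic_maps T S i j"
    unfolding homeomorphic_maps_def using 1 2 ji top by auto
  then show ?thesis by (rule that)
qed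

lemma weak_hausdorff_space_test:
  fixes X :: "'a topology" and T :: "'t topology"
  assumes X: "weak_hausdorff_space X"
    and T: "compact_space T" "Hausdorff_space T" and u: "continuous_map T X u"
  shows "closedin X (u ` topspace T)"
proof -
  define s where "s = inv_into (topspace T) u"
  define D where "D = s ` (u ` topspace T)"
  define C where "C = T closure_of D"
  define i where "i t = {{a \<in> u ` topspace T. s a \<in> V} | V. openin T V \<and> t \<in> V}" for t
  have s: "s a \<in> topspace T" "u (s a) = a" if "a \<in> u ` topspace T" for a
    using that by (auto simp: s_def inv_into_into f_inv_into_f)
  have DT: "D \<subseteq> topspace T" using s by (auto simp: D_def)
  have CT: "C \<subseteq> topspace T" by (simp add: C_def closure_of_subset_topspace)
  have DC: "D \<subseteq> C" by (simp add: C_def DT closure_of_subset)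
  have img: "u ` C = u ` topspace T"
  proof
    show "u ` topspace T \<subseteq> u ` C"
    proof
      fix a assume a: "a \<in> u ` topspace T"
      then have "s a \<in> C" using DC by (auto simp: D_def)
      with s(2)[OF a] show "a \<in> u ` C" by (metis imageI)
    qed
  qed (use CT in auto)
  have "inj_on i C"
  proof (rule inj_onI, rule ccontr)
    fix x y assume xy: "x \<in> C" "y \<in> C" "i x = i y" "x \<noteq> y"
    then obtain V W where VW: "openin T V" "openin T W" "x \<in> V" "y \<in> W" "disjnt V W"
      using T(2) CT unfolding Hausdorff_space_def by (meson subsetD)
    then have "{a \<in> u ` topspace T. s a \<in> V} \<in> i x" unfolding i_def by blast
    then have "{a \<in> u ` topspace T. s a \<in> V} \<in> i y" using xy by simp
    then obtain V' where V': "openin T V'" "y \<in> V'"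
      "{a \<in> u ` topspace T. s a \<in> V} = {a \<in> u ` topspace T. s a \<in> V'}"
      unfolding i_def by blast
    have "openin T (V' \<inter> W)" "y \<in> V' \<inter> W" using V' VW by auto
    then obtain d where "d \<in> D" "d \<in> V' \<inter> W"
      using xy(2) unfolding C_def in_closure_of by blast
    then show False using V'(3) VW(5) unfolding D_def disjnt_iff by blast
  qed
  moreover have topC: "topspace (subtopology T C) = C" using CT by auto
  ultimately obtain S :: "'a set set topology" and j where
    S: "homeomorphic_maps (subtopology T C) S i j"
    by (metis ex_homeomorphic_copy)
  have "compact_space (subtopology T C)"
    using T(1) by (simp add: C_def closedin_compact_space compact_space_subtopology)
  then have 1: "compact_space S"
    using S homeomorphic_compact_space homeomorphic_space_def by blast
  have 2: "Hausdorff_space S"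
    using S T(2) Hausdorff_space_subtopology homeomorphic_Hausdorff_space
      homeomorphic_space_def by blast
  have "continuous_map (subtopology T C) X u"
    by (simp add: continuous_map_from_subtopology u)
  then have 3: "continuous_map S X (u \<circ> j)"
    using S unfolding homeomorphic_maps_def by (blast intro: continuous_map_compose)
  have "j ` topspace S = C"
    using S topC by (metis homeomorphic_imp_surjective_map homeomorphic_maps_map)
  then have "(u \<circ> j) ` topspace S = u ` topspace T" using img by (metis image_comp)
  then show ?thesis using X 1 2 3 unfolding weak_hausdorff_space_def by metis
qed

lemma compactly_generated_space_test:
  fixes X :: "'a topology" and T :: "'t topology"
  assumes X: "weak_hausdorff_space X"
    and A: "\<And>(S :: 'a set set topology) v.
      \<lbrakk>compact_space S; Hausdorff_space S; continuous_map S X v\<rbrakk>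
        \<Longrightarrow> closedin S {t \<in> topspace S. v t \<in> A}"
    and T: "compact_space T" "Hausdorff_space T" and u: "continuous_map T X u"
  shows "closedin T {t \<in> topspace T. u t \<in> A}"
proof -
  define C where "C = u ` topspace T"
  have CX: "C \<subseteq> topspace X" using u by (auto simp: C_def continuous_map_def)
  have clo: "closedin X (u ` F)" if "closedin T F" for F
  proof -
    have "F = topspace (subtopology T F)" using closedin_subset[OF that] by auto
    moreover have "closedin X (u ` topspace (subtopology T F))"
      by (rule weak_hausdorff_space_test[OF X])
        (use T u that in \<open>auto simp: Hausdorff_space_subtopology closedin_compact_space
            compact_space_subtopology continuous_map_from_subtopology\<close>)
    ultimately show ?thesis by simp
  qed
  have uC: "continuous_map T (subtopology X C) u"
    using u by (auto simp: C_def continuous_map_in_subtopology)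
  have comp: "compact_space (subtopology X C)"
    unfolding C_def using T(1) u
    by (metis compact_space_def image_compactin compact_space_subtopology)
  have haus: "Hausdorff_space (subtopology X C)"
    unfolding Hausdorff_space_def
  proof (intro allI impI)
    fix x y assume xy: "x \<in> topspace (subtopology X C) \<and> y \<in> topspace (subtopology X C) \<and> x \<noteq> y"
    then have "x \<in> C" "y \<in> C" by auto
    have pt: "closedin T {t \<in> topspace T. u t \<in> {c}}" if c: "c \<in> C" for c
    proof -
      obtain t where t: "t \<in> topspace T" "u t = c" using c by (auto simp: C_def)
      have "closedin T {t}" using T(2) t(1) by (simp add: closedin_Hausdorff_sing_eq)
      from clo[OF this] have "closedin X {c}" using t by simp
      then show ?thesis using u closedin_continuous_map_preimage by blast
    qed
    have "normal_space T" using T compact_Hausdorff_or_regular_imp_normal_space by blast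
    moreover have "disjnt {t \<in> topspace T. u t \<in> {x}} {t \<in> topspace T. u t \<in> {y}}"
      using xy by (auto simp: disjnt_iff)
    ultimately obtain V W where VW: "openin T V" "openin T W"
        "{t \<in> topspace T. u t \<in> {x}} \<subseteq> V" "{t \<in> topspace T. u t \<in> {y}} \<subseteq> W" "disjnt V W"
      using pt[OF \<open>x \<in> C\<close>] pt[OF \<open>y \<in> C\<close>] unfolding normal_space_def by meson
    have op: "openin (subtopology X C) (C - u ` (topspace T - V))" if "openin T V" for V
    proof -
      have "closedin X (u ` (topspace T - V))" using clo that by blast
      then have "openin X (topspace X - u ` (topspace T - V))" by blast
      moreover have "C - u ` (topspace T - V) = C \<inter> (topspace X - u ` (topspace T - V))"
        using CX by auto
      ultimately show ?thesis by (metis inf_commute openin_subtopology)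
    qed
    show "\<exists>U V. openin (subtopology X C) U \<and> openin (subtopology X C) V \<and> x \<in> U \<and> y \<in> V \<and> disjnt U V"
    proof (intro exI conjI)
      show "x \<in> C - u ` (topspace T - V)" using \<open>x \<in> C\<close> VW(3) by auto
      show "y \<in> C - u ` (topspace T - W)" using \<open>y \<in> C\<close> VW(4) by auto
      show "disjnt (C - u ` (topspace T - V)) (C - u ` (topspace T - W))"
        using VW(5) by (auto simp: C_def disjnt_iff)
    qed (use op VW in auto)
  qed
  have "inj_on (\<lambda>a. {{a}}) (topspace (subtopology X C))" by (auto simp: inj_on_def)
  then obtain S :: "'a set set topology" and j where
    S: "homeomorphic_maps (subtopology X C) S (\<lambda>a. {{a}}) j"
    by (rule ex_homeomorphic_copy)
  have "continuous_map S (subtopology X C) j" using S by (simp add: homeomorphic_maps_def)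
  then have cj: "continuous_map S X j" by (simp add: continuous_map_in_subtopology)
  have "closedin S {t \<in> topspace S. j t \<in> A}"
    by (rule A[OF _ _ cj])
      (use S comp haus homeomorphic_compact_space homeomorphic_Hausdorff_space
          homeomorphic_space_def in blast)+
  moreover have "continuous_map T S ((\<lambda>a. {{a}}) \<circ> u)"
    using S uC unfolding homeomorphic_maps_def by (blast intro: continuous_map_compose)
  ultimately have "closedin T {t \<in> topspace T. ((\<lambda>a. {{a}}) \<circ> u) t \<in> {t \<in> topspace S. j t \<in> A}}"
    using closedin_continuous_map_preimage by blast
  moreover have "{{u t}} \<in> topspace S" "j {{u t}} = u t" if "t \<in> topspace T" for t
  proof -
    have "u t \<in> topspace (subtopology X C)" using that CX by (auto simp: C_def)
    then show "{{u t}} \<in> topspace S" "j {{u t}} = u t"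
      using S unfolding homeomorphic_maps_def continuous_map_def by blast+
  qed
  then have "{t \<in> topspace T. ((\<lambda>a. {{a}}) \<circ> u) t \<in> {t \<in> topspace S. j t \<in> A}} = {t \<in> topspace T. u t \<in> A}"
    by auto
  ultimately show ?thesis by simp
qed


section \<open>The singular cohomology ring\<close>

text \<open>
  A cochain is an element of \<open>\<Oplus>\<^sub>n C\<^sup>n(X; K)\<close>: it assigns to a degree \<open>n\<close> and a singular \<open>n\<close>-simplex
  of \<open>X\<close> an element of the coefficient field, is extended by zero to all other functions, and vanishes
  identically in almost all degrees.
\<close>

type_synonym ('a, 'k) cochain = "nat \<Rightarrow> ((nat \<Rightarrow> real) \<Rightarrow> 'a) \<Rightarrow> 'k"

definition cochains :: "'a topology \<Rightarrow> ('a, 'k::field) cochain set" where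
  "cochains X =
    {c. (\<forall>n \<sigma>. \<not> singular_simplex n X \<sigma> \<longrightarrow> c n \<sigma> = 0) \<and> finite {n. \<exists>\<sigma>. c n \<sigma> \<noteq> 0}}"

definition in_degree :: "nat \<Rightarrow> ('a, 'k::field) cochain \<Rightarrow> bool" where
  "in_degree p c \<longleftrightarrow> (\<forall>n \<sigma>. n \<noteq> p \<longrightarrow> c n \<sigma> = 0)"

definition coboundary :: "'a topology \<Rightarrow> ('a, 'k::field) cochain \<Rightarrow> ('a, 'k) cochain" where
  "coboundary X c n \<sigma> =
    (if 0 < n \<and> singular_simplex n X \<sigma>
     then \<Sum>k\<le>n. (- 1) ^ k * c (n - 1) (singular_face n k \<sigma>) else 0)"

text \<open>
  The \<open>p\<close>-simplex spanned by the first \<open>p + 1\<close> vertices of a simplex, and the \<open>q\<close>-simplex spanned by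
  the vertices with numbers \<open>p, \<dots>, p + q\<close>. Since \<^term>\<open>standard_simplex p\<close> consists of sequences
  that vanish beyond \<open>p\<close>, the front face is a mere restriction.
\<close>

definition front_face :: "nat \<Rightarrow> ((nat \<Rightarrow> real) \<Rightarrow> 'a) \<Rightarrow> (nat \<Rightarrow> real) \<Rightarrow> 'a" where
  "front_face p \<sigma> = restrict \<sigma> (standard_simplex p)"

definition back_face :: "nat \<Rightarrow> nat \<Rightarrow> ((nat \<Rightarrow> real) \<Rightarrow> 'a) \<Rightarrow> (nat \<Rightarrow> real) \<Rightarrow> 'a" where
  "back_face p q \<sigma> = (\<lambda>x \<in> standard_simplex q. \<sigma> (\<lambda>i. if i < p then 0 else x (i - p)))"

definition cup_product ::
    "'a topology \<Rightarrow> ('a, 'k::field) cochain \<Rightarrow> ('a, 'k) cochain \<Rightarrow> ('a, 'k) cochain" where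
  "cup_product X c d n \<sigma> =
    (if singular_simplex n X \<sigma>
     then \<Sum>p\<le>n. c p (front_face p \<sigma>) * d (n - p) (back_face p (n - p) \<sigma>) else 0)"

definition unit_cochain :: "'a topology \<Rightarrow> ('a, 'k::field) cochain" where
  "unit_cochain X n \<sigma> = (if n = 0 \<and> singular_simplex 0 X \<sigma> then 1 else 0)"

definition cocycle_ring :: "'a topology \<Rightarrow> ('a, 'k::field) cochain ring" where
  "cocycle_ring X =
    \<lparr>carrier = {c \<in> cochains X. coboundary X c = (\<lambda>_ _. 0)},
     mult = cup_product X,
     one = unit_cochain X,
     zero = (\<lambda>_ _. 0),
     add = (\<lambda>c d n \<sigma>. c n \<sigma> + d n \<sigma>)\<rparr>"

definition coboundaries :: "'a topology \<Rightarrow> ('a, 'k::field) cochain set" where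
  "coboundaries X = coboundary X ` cochains X"

definition cohomology_ring :: "'a topology \<Rightarrow> ('a, 'k::field) cochain set ring" where
  "cohomology_ring X = cocycle_ring X Quot coboundaries X"

text \<open>The homogeneous component \<open>H\<^sup>p(X; K)\<close> of the cohomology ring.\<close>

definition cohomology_group :: "'a topology \<Rightarrow> nat \<Rightarrow> ('a, 'k::field) cochain set set" where
  "cohomology_group X p =
    {coboundaries X +>\<^bsub>cocycle_ring X\<^esub> c | c. c \<in> carrier (cocycle_ring X) \<and> in_degree p c}"

definition cochain_map ::
    "'a topology \<Rightarrow> ('a \<Rightarrow> 'b) \<Rightarrow> ('b, 'k::field) cochain \<Rightarrow> ('a, 'k) cochain" where
  "cochain_map X f c n \<sigma> = (if singular_simplex n X \<sigma> then c n (simplex_map n f \<sigma>) else 0)"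

text \<open>
  The map \<open>H\<^sup>*(f) : H\<^sup>*(Y) \<rightarrow> H\<^sup>*(X)\<close> for \<open>f : X \<rightarrow> Y\<close>. The pointwise pullback of a
  cohomology class \<open>z + B(Y)\<close> is contained in the class \<open>B(X) + f\<^sup>#z\<close> but need not exhaust it, hence
  the addition of the coboundaries of \<open>X\<close>. The space \<open>Y\<close> is determined by the argument.
\<close>

definition cohomology_map ::
    "'a topology \<Rightarrow> ('a \<Rightarrow> 'b) \<Rightarrow> ('b, 'k::field) cochain set \<Rightarrow> ('a, 'k) cochain set" where
  "cohomology_map X f \<alpha> = coboundaries X <+>\<^bsub>cocycle_ring X\<^esub> cochain_map X f ` \<alpha>"

text \<open>The graded ring \<open>im(H\<^sup>*(f))\<close>: the underlying ring and its homogeneous components.\<close>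

definition image_ring ::
    "'a topology \<Rightarrow> 'b topology \<Rightarrow> ('a \<Rightarrow> 'b) \<Rightarrow> ('a, 'k::field) cochain set ring" where
  "image_ring X Y f = (cohomology_ring X)\<lparr>carrier := cohomology_map X f ` carrier (cohomology_ring Y)\<rparr>"

definition image_group ::
    "'a topology \<Rightarrow> 'b topology \<Rightarrow> ('a \<Rightarrow> 'b) \<Rightarrow> nat \<Rightarrow> ('a, 'k::field) cochain set set" where
  "image_group X Y f p = cohomology_map X f ` cohomology_group Y p"


section \<open>Persistent cup-length and persistent LS-category\<close>

text \<open>
  A graded ring is given by a ring \<open>R\<close> and its homogeneous components \<open>G\<close>. In \<^typ>\<open>enat\<close> the supremum
  is the maximum if there is one, \<open>\<infinity>\<close> for an unbounded set, and \<open>0\<close> for the empty set. The latter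
  only arises for the zero ring, where even the empty product vanishes.
\<close>

definition len :: "('r, 'm) ring_scheme \<Rightarrow> (nat \<Rightarrow> 'r set) \<Rightarrow> enat" where
  "len R G =
    Sup {enat (length xs) | xs.
           (\<forall>x \<in> set xs. \<exists>p>0. x \<in> G p) \<and> foldr (mult R) xs \<one>\<^bsub>R\<^esub> \<noteq> \<zero>\<^bsub>R\<^esub>}"

definition null_homotopic :: "'a topology \<Rightarrow> 'b topology \<Rightarrow> ('a \<Rightarrow> 'b) \<Rightarrow> bool" where
  "null_homotopic X Y f \<longleftrightarrow> (\<exists>y. homotopic_with (\<lambda>_. True) X Y f (\<lambda>_. y))"

lemma null_homotopic_empty: "null_homotopic (subtopology X {}) Y f"
  unfolding null_homotopic_def by (simp add: homotopic_on_emptyI)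

text \<open>The infimum of the empty set in \<^typ>\<open>enat\<close> is \<open>\<infinity>\<close>; \<open>{..n}\<close> has \<open>n + 1\<close> elements.\<close>

definition LS_cat :: "'a topology \<Rightarrow> 'b topology \<Rightarrow> ('a \<Rightarrow> 'b) \<Rightarrow> enat" where
  "LS_cat X Y f =
    Inf {enat n | n. \<exists>U :: nat \<Rightarrow> 'a set.
           (\<forall>i\<le>n. openin X (U i) \<and> null_homotopic (subtopology X (U i)) Y f)
           \<and> (\<Union>i\<le>n. U i) = topspace X}"

text \<open>
  A functor from \<open>(\<real>, \<le>)\<close>; \<open>f a b\<close> is only meaningful for \<open>a \<le> b\<close> and on points of \<open>X a\<close>. That all
  \<open>X a\<close> live on the same type is no restriction, since \<open>topspace (X a)\<close> may be any subset of it.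
\<close>

definition persistent_space ::
    "(real \<Rightarrow> 'a topology) \<Rightarrow> (real \<Rightarrow> real \<Rightarrow> 'a \<Rightarrow> 'a) \<Rightarrow> bool" where
  "persistent_space X f \<longleftrightarrow>
    (\<forall>a. CGWH_space (X a)) \<and>
    (\<forall>a b. a \<le> b \<longrightarrow> continuous_map (X a) (X b) (f a b)) \<and>
    (\<forall>a. \<forall>x \<in> topspace (X a). f a a x = x) \<and>
    (\<forall>a b c. a \<le> b \<and> b \<le> c \<longrightarrow> (\<forall>x \<in> topspace (X a). f b c (f a b x) = f a c x))"

definition persistent_cup ::
    "'k::field itself \<Rightarrow> (real \<Rightarrow> 'a topology) \<Rightarrow> (real \<Rightarrow> real \<Rightarrow> 'a \<Rightarrow> 'a) \<Rightarrow> real \<Rightarrow> real \<Rightarrow> enat" where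
  "persistent_cup _ X f a b =
    len (image_ring (X a) (X b) (f a b) :: ('a, 'k) cochain set ring)
        (image_group (X a) (X b) (f a b))"

definition persistent_cat ::
    "(real \<Rightarrow> 'a topology) \<Rightarrow> (real \<Rightarrow> real \<Rightarrow> 'a \<Rightarrow> 'a) \<Rightarrow> real \<Rightarrow> real \<Rightarrow> enat" where
  "persistent_cat X f a b = LS_cat (X a) (X b) (f a b)"

end

theory Submission
  imports Defs
begin

text \<open>
  Let \<open>U\<^sub>0, \<dots>, U\<^sub>n\<close> be an open cover such that \<open>f\<close> is null-homotopic on each \<open>U\<^sub>i\<close>. A positive-degree
  cocycle pulled back along \<open>f\<close> becomes a coboundary on \<open>U\<^sub>i\<close>: evaluating it on the cones that the
  null-homotopy puts over the simplices of \<open>U\<^sub>i\<close> gives a primitive. Extending the primitive by zero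
  and subtracting its coboundary yields a cohomologous cocycle on the whole space that vanishes on
  the simplices of \<open>U\<^sub>i\<close>. A cup product with more than \<open>n\<close> factors is therefore represented by a
  cocycle that vanishes on every simplex contained in some \<open>U\<^sub>i\<close>, and by iterated barycentric
  subdivision such a cocycle is a coboundary.
\<close>

section \<open>Cochains and the cup product\<close>

lemma cochainsI:
  assumes "\<And>n \<sigma>. \<not> singular_simplex n X \<sigma> \<Longrightarrow> c n \<sigma> = 0"
    and "{n. \<exists>\<sigma>. c n \<sigma> \<noteq> 0} \<subseteq> N" and "finite N"
  shows "c \<in> cochains X"
  using assms finite_subset by (auto simp: cochains_def)

lemma cochain_outside: "c \<in> cochains X \<Longrightarrow> \<not> singular_simplex n X \<sigma> \<Longrightarrow> c n \<sigma> = 0"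
  by (simp add: cochains_def)

lemma finite_cochain_degrees: "c \<in> cochains X \<Longrightarrow> finite {n. \<exists>\<sigma>. c n \<sigma> \<noteq> 0}"
  by (simp add: cochains_def)

lemma cochains_add:
  assumes "c \<in> cochains X" "d \<in> cochains X"
  shows "(\<lambda>n \<sigma>. c n \<sigma> + d n \<sigma>) \<in> cochains X"
  by (rule cochainsI[where N = "{n. \<exists>\<sigma>. c n \<sigma> \<noteq> 0} \<union> {n. \<exists>\<sigma>. d n \<sigma> \<noteq> 0}"])
    (use assms in \<open>auto simp: cochain_outside finite_cochain_degrees\<close>)

text \<open>The weight may depend on the degree: besides the constant -1 for differences, this
  covers the sign \<open>(- 1) ^ n\<close> of the Leibniz rule.\<close>

lemma cochains_mult_left:
  assumes "c \<in> cochains X"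
  shows "(\<lambda>n \<sigma>. e n * c n \<sigma>) \<in> cochains X"
  by (rule cochainsI[where N = "{n. \<exists>\<sigma>. c n \<sigma> \<noteq> 0}"])
    (use assms in \<open>auto simp: cochain_outside finite_cochain_degrees\<close>)

lemma cochains_diff:
  assumes "c \<in> cochains X" "d \<in> cochains X"
  shows "(\<lambda>n \<sigma>. c n \<sigma> - d n \<sigma>) \<in> cochains X"
  using cochains_add[OF assms(1) cochains_mult_left[OF assms(2), of "\<lambda>_. - 1"]] by simp

lemma cochains_zero: "(\<lambda>_ _. 0) \<in> cochains X"
  by (simp add: cochains_def)

lemma coboundary_degree_0 [simp]: "coboundary X c 0 \<sigma> = 0"
  by (simp add: coboundary_def)

lemma coboundary_add:
  "coboundary X (\<lambda>n \<sigma>. c n \<sigma> + d n \<sigma>) = (\<lambda>n \<sigma>. coboundary X c n \<sigma> + coboundary X d n \<sigma>)"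
  by (auto simp: coboundary_def fun_eq_iff algebra_simps sum.distrib)

lemma coboundary_diff:
  "coboundary X (\<lambda>n \<sigma>. c n \<sigma> - d n \<sigma>) = (\<lambda>n \<sigma>. coboundary X c n \<sigma> - coboundary X d n \<sigma>)"
  by (auto simp: coboundary_def fun_eq_iff algebra_simps sum_subtractf)

lemma coboundary_zero [simp]: "coboundary X (\<lambda>_ _. 0) = (\<lambda>_ _. 0)"
  by (auto simp: coboundary_def fun_eq_iff)

text \<open>The coboundary raises the degree by one, so the sign changes once. In particular the
  twist by \<open>(- 1) ^ n\<close> preserves cocycles.\<close>

lemma coboundary_alternating:
  "coboundary X (\<lambda>n \<sigma>. (- 1) ^ n * c n \<sigma>) = (\<lambda>n \<sigma>. - ((- 1) ^ n * coboundary X c n \<sigma>))"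
proof (intro ext)
  fix n \<sigma>
  show "coboundary X (\<lambda>n \<sigma>. (- 1) ^ n * c n \<sigma>) n \<sigma> = - ((- 1) ^ n * coboundary X c n \<sigma>)"
    by (cases n) (auto simp: coboundary_def sum_distrib_left sum_negf algebra_simps)
qed

lemma coboundary_in_cochains:
  assumes "c \<in> cochains X"
  shows "coboundary X c \<in> cochains X"
proof -
  have "{n. \<exists>\<sigma>. coboundary X c n \<sigma> \<noteq> 0} \<subseteq> Suc ` {n. \<exists>\<sigma>. c n \<sigma> \<noteq> 0}"
  proof
    fix n assume "n \<in> {n. \<exists>\<sigma>. coboundary X c n \<sigma> \<noteq> 0}"
    then obtain \<sigma> where "coboundary X c n \<sigma> \<noteq> 0" by blast
    then have n: "0 < n" and "(\<Sum>k\<le>n. (- 1) ^ k * c (n - 1) (singular_face n k \<sigma>)) \<noteq> 0"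
      by (auto simp: coboundary_def split: if_splits)
    then obtain k where "c (n - 1) (singular_face n k \<sigma>) \<noteq> 0"
      by (metis (no_types, lifting) mult_zero_right sum.neutral)
    then show "n \<in> Suc ` {n. \<exists>\<sigma>. c n \<sigma> \<noteq> 0}"
      using n by (auto intro!: image_eqI[of _ _ "n - 1"])
  qed
  then show ?thesis
    by (rule cochainsI[rotated])
      (use assms in \<open>auto simp: finite_cochain_degrees coboundary_def\<close>)
qed

section \<open>Front and back faces of singular simplices\<close>

lemma singular_simplex_front_face:
  assumes "singular_simplex n X \<sigma>" "p \<le> n"
  shows "singular_simplex p X (front_face p \<sigma>)"
proof -
  have "standard_simplex p \<subseteq> standard_simplex n"
    using assms by (simp add: standard_simplex_mono)
  then have "continuous_map (subtopology (powertop_real UNIV) (standard_simplex p)) X \<sigma>"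
    using assms continuous_map_from_subtopology_mono unfolding singular_simplex_def by blast
  then show ?thesis
    by (auto simp: singular_simplex_def front_face_def)
qed

lemma back_face_0:
  assumes "singular_simplex n X \<sigma>"
  shows "back_face 0 n \<sigma> = \<sigma>"
  using assms
  by (auto simp: singular_simplex_def back_face_def extensional_def fun_eq_iff)

text \<open>Dropping one more initial vertex is a 0th face. Back faces thus become iterated faces,
  and they are singular simplices by induction.\<close>

lemma back_face_Suc:
  "back_face (Suc p) q \<sigma> = singular_face (Suc q) 0 (back_face p (Suc q) \<sigma>)"
proof -
  have "(\<lambda>i. if i < Suc p then 0 else x (i - Suc p)) =
        (\<lambda>i. if i < p then 0 else simplical_face 0 x (i - p))" for x :: "nat \<Rightarrow> real"
    by (auto simp: simplical_face_def fun_eq_iff)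
  then show ?thesis
    using simplical_face_in_standard_simplex[of "Suc q" 0]
    by (auto simp: back_face_def singular_face_def fun_eq_iff)
qed

lemma singular_simplex_back_face:
  assumes "singular_simplex (p + q) X \<sigma>"
  shows "singular_simplex q X (back_face p q \<sigma>)"
  using assms
proof (induction p arbitrary: q)
  case 0
  then show ?case by (simp add: back_face_0)
next
  case (Suc p)
  then show ?case
    using singular_simplex_singular_face[of "Suc q" X "back_face p (Suc q) \<sigma>" 0]
    by (simp add: back_face_Suc)
qed

text \<open>The \<open>k\<close>th face map sends the \<open>p\<close>-simplex into the
  \<open>Suc p\<close>-simplex, so the inner restriction has no effect. Front faces of faces have
  the same right-hand side, which lets the two sides of the Leibniz rule be compared.\<close>

lemma front_face_singular_face_low:
  assumes "k \<le> Suc p"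
  shows "singular_face (Suc p) k (front_face (Suc p) \<sigma>) = restrict (\<sigma> \<circ> simplical_face k) (standard_simplex p)"
  using assms simplical_face_in_standard_simplex[of "Suc p" k]
  by (auto simp: front_face_def singular_face_def fun_eq_iff)

lemma front_face_of_singular_face:
  assumes "p \<le> m"
  shows "front_face p (singular_face (Suc m) k \<sigma>) = restrict (\<sigma> \<circ> simplical_face k) (standard_simplex p)"
  using standard_simplex_mono[OF assms]
  by (auto simp: front_face_def singular_face_def fun_eq_iff)

text \<open>The face map inserts a zero at a position beyond \<open>p\<close>, where all coordinates
  of the point are zero already.\<close>

lemma restrict_simplical_face_high:
  assumes "p < k"
  shows "restrict (\<sigma> \<circ> simplical_face k) (standard_simplex p) = front_face p \<sigma>"
proof -
  have "simplical_face k x = x" if "x \<in> standard_simplex p" for x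
    using assms that by (auto simp: standard_simplex_def simplical_face_def fun_eq_iff)
  then show ?thesis
    by (auto simp: front_face_def intro!: ext)
qed

lemma shift_in_standard_simplex:
  assumes "x \<in> standard_simplex q"
  shows "(\<lambda>i. if i < p then 0 else x (i - p)) \<in> standard_simplex (p + q)"
  using assms
proof (induction p)
  case (Suc p)
  have "(\<lambda>i. if i < Suc p then 0 else x (i - Suc p)) =
        simplical_face 0 (\<lambda>i. if i < p then 0 else x (i - p))"
    by (auto simp: simplical_face_def fun_eq_iff)
  then show ?case
    using Suc simplical_face_in_standard_simplex[of "Suc p + q" 0] by simp
qed simp

text \<open>Inserting one more zero among or right after \<open>p\<close> leading zeros gives
  \<open>Suc p\<close> leading zeros.\<close>

lemma back_face_of_singular_face_low:
  assumes "k \<le> p"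
  shows "back_face p q (singular_face (Suc (p + q)) k \<sigma>) = back_face (Suc p) q \<sigma>"
proof -
  have "simplical_face k (\<lambda>i. if i < p then 0 else x (i - p)) =
        (\<lambda>i. if i < Suc p then 0 else x (i - Suc p))" for x :: "nat \<Rightarrow> real"
    using assms by (auto simp: simplical_face_def fun_eq_iff)
  then show ?thesis
    using shift_in_standard_simplex[of _ q p]
    by (auto simp: back_face_def singular_face_def intro!: ext)
qed

text \<open>Past the \<open>p\<close> leading zeros, position \<open>p + j\<close> is position
  \<open>j\<close> of the back face.\<close>

lemma back_face_of_singular_face_high:
  assumes "j \<le> Suc q"
  shows "back_face p q (singular_face (Suc (p + q)) (p + j) \<sigma>) = singular_face (Suc q) j (back_face p (Suc q) \<sigma>)"
proof -
  have "simplical_face (p + j) (\<lambda>i. if i < p then 0 else x (i - p)) =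
        (\<lambda>i. if i < p then 0 else simplical_face j x (i - p))" for x :: "nat \<Rightarrow> real"
    using assms by (auto simp: simplical_face_def fun_eq_iff diff_diff_add add.commute)
  then show ?thesis
    using shift_in_standard_simplex[of _ q p] simplical_face_in_standard_simplex[of "Suc q" j] assms
    by (auto simp: back_face_def singular_face_def intro!: ext)
qed

section \<open>The cup product and its Leibniz rule\<close>

lemma cup_product_in_cochains:
  assumes "c \<in> cochains X" "d \<in> cochains X"
  shows "cup_product X c d \<in> cochains X"
proof -
  \<comment> \<open>The degrees of a product are sums of a degree of \<open>c\<close> and a degree
    of \<open>d\<close>, hence finitely many.\<close>
  have "{n. \<exists>\<sigma>. cup_product X c d n \<sigma> \<noteq> 0} \<subseteq>
        (\<lambda>(p, q). p + q) ` ({n. \<exists>\<sigma>. c n \<sigma> \<noteq> 0} \<times> {n. \<exists>\<sigma>. d n \<sigma> \<noteq> 0})"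
  proof
    fix n assume "n \<in> {n. \<exists>\<sigma>. cup_product X c d n \<sigma> \<noteq> 0}"
    then obtain \<sigma> where "cup_product X c d n \<sigma> \<noteq> 0" by blast
    then have "(\<Sum>p\<le>n. c p (front_face p \<sigma>) * d (n - p) (back_face p (n - p) \<sigma>)) \<noteq> 0"
      by (auto simp: cup_product_def split: if_splits)
    then obtain p where "p \<le> n" "c p (front_face p \<sigma>) * d (n - p) (back_face p (n - p) \<sigma>) \<noteq> 0"
      by (metis (no_types, lifting) atMost_iff sum.neutral)
    then show "n \<in> (\<lambda>(p, q). p + q) ` ({n. \<exists>\<sigma>. c n \<sigma> \<noteq> 0} \<times> {n. \<exists>\<sigma>. d n \<sigma> \<noteq> 0})"
      by (auto intro!: image_eqI[of _ _ "(p, n - p)"])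
  qed
  then show ?thesis
    by (rule cochainsI[rotated])
      (use assms in \<open>auto simp: finite_cochain_degrees cup_product_def\<close>)
qed

lemma cup_product_add_left:
  "cup_product X (\<lambda>n \<sigma>. c n \<sigma> + c' n \<sigma>) d = (\<lambda>n \<sigma>. cup_product X c d n \<sigma> + cup_product X c' d n \<sigma>)"
  by (auto simp: cup_product_def fun_eq_iff algebra_simps sum.distrib)

lemma cup_product_add_right:
  "cup_product X c (\<lambda>n \<sigma>. d n \<sigma> + d' n \<sigma>) = (\<lambda>n \<sigma>. cup_product X c d n \<sigma> + cup_product X c d' n \<sigma>)"
  by (auto simp: cup_product_def fun_eq_iff algebra_simps sum.distrib)

lemma cup_product_zero_left [simp]: "cup_product X (\<lambda>_ _. 0) d = (\<lambda>_ _. 0)"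
  by (auto simp: cup_product_def fun_eq_iff)

lemma cup_product_zero_right [simp]: "cup_product X c (\<lambda>_ _. 0) = (\<lambda>_ _. 0)"
  by (auto simp: cup_product_def fun_eq_iff)

text \<open>The sum over the faces \<open>k \<le> m + 1\<close> splits at \<open>p\<close>: the faces \<open>k \<le> p\<close> meet the front factor and the
  faces \<open>k > p\<close> the back factor; the two extra terms on the right-hand side, the last face
  of the front and the \<open>0\<close>th face of the back, cancel.\<close>

lemma coboundary_cup_product:
  fixes u v :: "('a, 'k::field) cochain"
  shows "coboundary X (cup_product X u v) =
    (\<lambda>n \<sigma>. cup_product X (coboundary X u) v n \<sigma>
       + cup_product X (\<lambda>n \<sigma>. (- 1) ^ n * u n \<sigma>) (coboundary X v) n \<sigma>)"
proof (intro ext)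
  fix n and \<sigma> :: "(nat \<Rightarrow> real) \<Rightarrow> 'a"
  show "coboundary X (cup_product X u v) n \<sigma> = cup_product X (coboundary X u) v n \<sigma>
       + cup_product X (\<lambda>n \<sigma>. (- 1) ^ n * u n \<sigma>) (coboundary X v) n \<sigma>"
  proof (cases "0 < n \<and> singular_simplex n X \<sigma>")
    case False
    then show ?thesis
      by (auto simp: coboundary_def cup_product_def)
  next
    case True
    then obtain m where n: "n = Suc m" and \<sigma>: "singular_simplex (Suc m) X \<sigma>"
      by (metis gr0_implies_Suc)
    \<comment> \<open>The factors that occur after expansion: \<open>U p k\<close> is the front
      factor with a face map applied, \<open>B p\<close> the back factor that starts at vertex
      \<open>Suc p\<close>, and \<open>V p j\<close> the back factor with its \<open>j\<close>th
      vertex omitted.\<close>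
    define U where "U p k = u p (restrict (\<sigma> \<circ> simplical_face k) (standard_simplex p))" for p k
    define B where "B p = v (m - p) (back_face (Suc p) (m - p) \<sigma>)" for p
    define V where "V p j = v (m - p) (singular_face (Suc (m - p)) j (back_face p (Suc (m - p)) \<sigma>))" for p j
    have V0: "V p 0 = B p" for p
      by (simp add: V_def B_def back_face_Suc)
    have Uhigh: "U p k = u p (front_face p \<sigma>)" if "p < k" for p k
      using that by (simp add: U_def restrict_simplical_face_high)
    have vlow: "v (m - p) (back_face p (m - p) (singular_face (Suc m) k \<sigma>)) = B p" if "k \<le> p" "p \<le> m" for p k
      using back_face_of_singular_face_low[OF that(1), of "m - p" \<sigma>] that by (simp add: B_def)
    have vhigh: "v (m - p) (back_face p (m - p) (singular_face (Suc m) (p + j) \<sigma>)) = V p j"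
      if "p \<le> m" "j \<le> Suc (m - p)" for p j
      using back_face_of_singular_face_high[OF that(2), of p \<sigma>] that by (simp add: V_def)
    have face: "singular_simplex m X (singular_face (Suc m) k \<sigma>)" if "k \<le> Suc m" for k
      using singular_simplex_singular_face[OF \<sigma> _ that] by simp
    have split: "(\<Sum>k\<le>Suc m. g k) = (\<Sum>k\<le>p. g k) + (\<Sum>j\<le>m - p. g (Suc (p + j)))"
      if "p \<le> m" for p and g :: "nat \<Rightarrow> 'k"
    proof -
      have "(\<Sum>j\<le>m - p. g (Suc (p + j))) = sum g {Suc p..Suc m}"
        by (rule sum.reindex_bij_witness[of _ "\<lambda>k. k - Suc p" "\<lambda>j. Suc (p + j)"]) (use that in auto)
      moreover have "{..Suc m} = {..p} \<union> {Suc p..Suc m}" using that by auto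
      ultimately show ?thesis by (simp add: sum.union_disjoint)
    qed
    have "coboundary X (cup_product X u v) n \<sigma> =
      (\<Sum>k\<le>Suc m. \<Sum>p\<le>m. (- 1) ^ k * (U p k * v (m - p) (back_face p (m - p) (singular_face (Suc m) k \<sigma>))))"
      using \<sigma> face
      by (simp add: coboundary_def n cup_product_def sum_distrib_left U_def front_face_of_singular_face
          del: sum.atMost_Suc)
    also have "\<dots> = (\<Sum>p\<le>m. \<Sum>k\<le>Suc m. (- 1) ^ k * (U p k * v (m - p) (back_face p (m - p) (singular_face (Suc m) k \<sigma>))))"
      by (rule sum.swap)
    also have "\<dots> = (\<Sum>p\<le>m. (\<Sum>k\<le>p. (- 1) ^ k * (U p k * B p))
       + (\<Sum>j\<le>m - p. (- 1) ^ Suc (p + j) * (u p (front_face p \<sigma>) * V p (Suc j))))"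
    proof (rule sum.cong[OF refl], goal_cases)
      case (1 p)
      then show ?case
        using vhigh[of p "Suc _"] by (simp add: split[of p] vlow Uhigh del: sum.atMost_Suc)
    qed
    finally have L: "coboundary X (cup_product X u v) n \<sigma> = \<dots>" .
    have "cup_product X (coboundary X u) v n \<sigma> =
       (\<Sum>p\<le>m. coboundary X u (Suc p) (front_face (Suc p) \<sigma>) * B p)"
      using \<sigma> by (simp add: n cup_product_def B_def sum.atMost_Suc_shift coboundary_def
          del: sum.atMost_Suc)
    also have "\<dots> = (\<Sum>p\<le>m. (\<Sum>k\<le>p. (- 1) ^ k * (U p k * B p)) - (- 1) ^ p * (u p (front_face p \<sigma>) * B p))"
    proof (rule sum.cong[OF refl], goal_cases)
      case (1 p)
      then have "singular_simplex (Suc p) X (front_face (Suc p) \<sigma>)"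
        using singular_simplex_front_face[OF \<sigma>, of "Suc p"] by simp
      moreover have "u p (singular_face (Suc p) k (front_face (Suc p) \<sigma>)) = U p k" if "k \<le> Suc p" for k
        using that by (simp add: U_def front_face_singular_face_low)
      ultimately show ?case
        by (simp add: coboundary_def Uhigh sum_distrib_left sum_distrib_right algebra_simps)
    qed
    finally have R1: "cup_product X (coboundary X u) v n \<sigma> = \<dots>" .
    have "cup_product X (\<lambda>n \<sigma>. (- 1) ^ n * u n \<sigma>) (coboundary X v) n \<sigma> =
       (\<Sum>p\<le>m. (- 1) ^ p * u p (front_face p \<sigma>) * coboundary X v (Suc (m - p)) (back_face p (Suc (m - p)) \<sigma>))"
      using \<sigma> by (simp add: n cup_product_def Suc_diff_le)
    also have "\<dots> = (\<Sum>p\<le>m. (- 1) ^ p * (u p (front_face p \<sigma>) * B p)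
       + (\<Sum>j\<le>m - p. (- 1) ^ Suc (p + j) * (u p (front_face p \<sigma>) * V p (Suc j))))"
    proof (rule sum.cong[OF refl], goal_cases)
      case (1 p)
      then have "singular_simplex (Suc (m - p)) X (back_face p (Suc (m - p)) \<sigma>)"
        using \<sigma> by (auto intro: singular_simplex_back_face)
      then show ?case
        by (simp add: coboundary_def V_def[symmetric] V0 sum.atMost_Suc_shift sum_distrib_left
            power_add algebra_simps del: sum.atMost_Suc)
    qed
    finally have R2: "cup_product X (\<lambda>n \<sigma>. (- 1) ^ n * u n \<sigma>) (coboundary X v) n \<sigma> = \<dots>" .
    show ?thesis
      unfolding L R1 R2 by (simp add: sum.distrib[symmetric])
  qed
qed

section \<open>Cocycles vanishing on small simplices\<close>

text \<open>The Kronecker pairing of one degree of a cochain with an integral chain; it gives access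
  to the chain operators on free abelian groups.\<close>

definition chain_eval :: "('b \<Rightarrow> 'k::field) \<Rightarrow> ('b \<Rightarrow>\<^sub>0 int) \<Rightarrow> 'k" where
  "chain_eval c x = (\<Sum>\<sigma>\<in>Poly_Mapping.keys x. of_int (poly_mapping.lookup x \<sigma>) * c \<sigma>)"

lemma chain_eval_superset:
  assumes "finite A" "Poly_Mapping.keys x \<subseteq> A"
  shows "chain_eval c x = (\<Sum>\<sigma>\<in>A. of_int (poly_mapping.lookup x \<sigma>) * c \<sigma>)"
  unfolding chain_eval_def
  by (rule sum.mono_neutral_left) (use assms in \<open>auto simp: in_keys_iff\<close>)

lemma chain_eval_diff: "chain_eval c (x - y) = chain_eval c x - chain_eval c y"
proof -
  let ?A = "Poly_Mapping.keys x \<union> Poly_Mapping.keys y"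
  have "chain_eval c (x - y) = (\<Sum>\<sigma>\<in>?A. of_int (poly_mapping.lookup (x - y) \<sigma>) * c \<sigma>)"
    by (rule chain_eval_superset) (auto simp: keys_diff)
  then show ?thesis
    using chain_eval_superset[of ?A x c] chain_eval_superset[of ?A y c]
    by (simp add: lookup_minus sum_subtractf algebra_simps)
qed

lemma chain_eval_of [simp]: "chain_eval c (frag_of \<sigma>) = c \<sigma>"
  by (simp add: chain_eval_def)

lemma chain_eval_eq_0: "(\<And>\<sigma>. \<sigma> \<in> Poly_Mapping.keys x \<Longrightarrow> c \<sigma> = 0) \<Longrightarrow> chain_eval c x = 0"
  by (simp add: chain_eval_def)

text \<open>Compatibility with differences already forces additivity, and the coefficients are only
  signs. The map \<open>g\<close> is general so that the lemma serves both \<open>chain_eval\<close>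
  and its composition with a chain operator.\<close>

lemma additive_alternating_sum:
  fixes g :: "('b \<Rightarrow>\<^sub>0 int) \<Rightarrow> 'k::field"
  assumes g: "\<And>x y. g (x - y) = g x - g y" and "finite A"
  shows "g (\<Sum>k\<in>A. frag_cmul ((- 1) ^ k) (frag_of (s k))) = (\<Sum>k\<in>A. (- 1) ^ k * g (frag_of (s k)))"
proof -
  have g0: "g 0 = 0" using g[of 0 0] by simp
  have gm: "g (- x) = - g x" for x using g[of 0 x] g0 by simp
  have ga: "g (x + y) = g x + g y" for x y using g[of x "- y"] gm by simp
  have gk: "g (frag_cmul ((- 1) ^ k) x) = (- 1) ^ k * g x" for k x
    by (cases "even k") (simp_all add: gm)
  show ?thesis
    using \<open>finite A\<close> by (induction rule: finite_induct) (simp_all add: g0 ga gk)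
qed

text \<open>Both sides are additive in the chain, and on a single simplex the claim is the
  definition of the coboundary.\<close>

lemma chain_eval_boundary:
  assumes "singular_chain (Suc n) X x"
  shows "chain_eval (c n) (chain_boundary (Suc n) x) = chain_eval (coboundary X c (Suc n)) x"
  using assms unfolding singular_chain_def
proof (induction rule: frag_induction)
  case (one \<sigma>)
  then show ?case
    using additive_alternating_sum[of "chain_eval (c n)" "{..Suc n}"]
    by (simp add: chain_boundary_of coboundary_def chain_eval_diff del: sum.atMost_Suc)
next
  case (diff a b)
  then show ?case
    by (simp add: chain_boundary_diff chain_eval_diff)
qed (simp add: chain_eval_def)

text \<open>Dual to the vanishing of the double boundary. Below degree 2 no duality is involved,
  since coboundaries vanish in degree 0.\<close>

lemma coboundary_coboundary: "coboundary X (coboundary X c) = (\<lambda>_ _. 0)"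
proof (intro ext)
  fix n \<sigma>
  consider "n = 0" | "n = 1" | m where "n = Suc (Suc m)"
    by (metis One_nat_def not0_implies_Suc)
  then show "coboundary X (coboundary X c) n \<sigma> = 0"
  proof cases
    case (3 m)
    show ?thesis
    proof (cases "singular_simplex n X \<sigma>")
      case True
      then have 1: "singular_chain (Suc (Suc m)) X (frag_of \<sigma>)"
        by (simp add: singular_chain_of 3)
      have "coboundary X (coboundary X c) n \<sigma> =
          chain_eval (coboundary X c (Suc m)) (chain_boundary (Suc (Suc m)) (frag_of \<sigma>))"
        by (simp add: chain_eval_boundary[OF 1] 3)
      also have "\<dots> = chain_eval (c m) (chain_boundary (Suc m) (chain_boundary (Suc (Suc m)) (frag_of \<sigma>)))"
        using chain_eval_boundary singular_chain_boundary_alt[OF 1] by metis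
      also have "\<dots> = 0"
        using chain_boundary_boundary_alt[OF 1] by (simp add: chain_eval_def)
      finally show ?thesis .
    qed (simp add: coboundary_def)
  qed (auto simp: coboundary_def)
qed

section \<open>Primitives from iterated subdivision\<close>

lemma coboundariesI: "u \<in> cochains X \<Longrightarrow> c = coboundary X u \<Longrightarrow> c \<in> coboundaries X"
  by (auto simp: coboundaries_def)

text \<open>With \<open>T\<close> the chain homotopy from the identity to the subdivision \<open>S\<close>, the operator
  \<open>D\<^sub>m = T + T S + \<dots> + T S\<^sup>m\<^sup>-\<^sup>1\<close> is a chain homotopy from the identity to \<open>S\<^sup>m\<close>. A primitive of \<open>z\<close> sends
  \<open>\<tau>\<close> to \<open>-z (D\<^sub>m \<tau>)\<close> for any \<open>m\<close> such that all further subdivisions of \<open>\<tau>\<close> are small. The value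
  does not depend on \<open>m\<close>, so that one \<open>m\<close> serves a simplex and all its faces.\<close>

lemma coboundaries_if_vanishes_on_small:
  fixes z :: "('a, 'k::field) cochain"
  assumes z: "z \<in> carrier (cocycle_ring X)"
    and U: "\<And>U. U \<in> \<U> \<Longrightarrow> openin X U" "topspace X \<subseteq> \<Union>\<U>"
    and small: "\<And>U n \<sigma>. U \<in> \<U> \<Longrightarrow> singular_simplex n (subtopology X U) \<sigma> \<Longrightarrow> z n \<sigma> = 0"
  shows "z \<in> coboundaries X"
proof -
  have zc: "z \<in> cochains X" and dz: "coboundary X z = (\<lambda>_ _. 0)"
    using z by (auto simp: cocycle_ring_def)
  obtain T :: "nat \<Rightarrow> 'a chain \<Rightarrow> 'a chain" where T0: "\<And>p. T p 0 = 0"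
    and Td: "\<And>p c1 c2. T p (c1 - c2) = T p c1 - T p c2"
    and Tc: "\<And>p X c. singular_chain p X c \<Longrightarrow> singular_chain (Suc p) X (T p c)"
    and TS: "\<And>p X c. singular_chain p X c \<Longrightarrow>
      chain_boundary (Suc p) (T p c) + T (p - Suc 0) (chain_boundary p c) = singular_subdivision p c - c"
    by (rule chain_homotopic_singular_subdivision) blast
  define S :: "nat \<Rightarrow> nat \<Rightarrow> 'a chain \<Rightarrow> 'a chain" where "S p i = singular_subdivision p ^^ i" for p i
  define D where "D p m c = (\<Sum>i<m. T p (S p i c))" for p m c
  \<comment> \<open>The small simplices: those inside a single member of the cover.\<close>
  define Sm where "Sm p = {\<sigma>. \<exists>V\<in>\<U>. singular_simplex p (subtopology X V) \<sigma>}" for p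
  have zSm: "chain_eval (z p) c = 0" if "Poly_Mapping.keys c \<subseteq> Sm p" for p c
    by (rule chain_eval_eq_0) (use that small in \<open>auto simp: Sm_def\<close>)
  \<comment> \<open>\<open>T\<close> is one operator for all spaces at once. Applied to a simplex of
    the subspace \<open>V\<close> it yields a chain of \<open>V\<close>, so smallness is
    preserved.\<close>
  have TSm: "Poly_Mapping.keys (T p c) \<subseteq> Sm (Suc p)" if "Poly_Mapping.keys c \<subseteq> Sm p" for p c
    using that
  proof (induction rule: frag_induction)
    case (one \<sigma>)
    then obtain V where "V \<in> \<U>" "singular_chain p (subtopology X V) (frag_of \<sigma>)"
      by (auto simp: Sm_def singular_chain_of)
    then show ?case
      using Tc unfolding Sm_def singular_chain_def by blast
  next
    case (diff a b)
    then show ?case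
      using keys_diff[of "T p a" "T p b"] by (auto simp: Td)
  qed (simp add: T0)
  have Sc: "singular_chain p X (S p i c)" if "singular_chain p X c" for p i c
    unfolding S_def by (induction i) (simp_all add: that singular_chain_singular_subdivision)
  have Sd: "S p i (a - b) = S p i a - S p i b" for p i and a b :: "'a chain"
    unfolding S_def by (rule singular_subdivision_power_diff)
  have Dd: "D p m (a - b) = D p m a - D p m b" for p m a b
    by (simp add: D_def Sd Td sum_subtractf)
  have Sb: "chain_boundary p (S p i c) = S (p - Suc 0) i (chain_boundary p c)"
    if "singular_chain p X c" for p i c
    using Sc[OF that] unfolding S_def
    by (induction i) (simp_all add: chain_boundary_singular_subdivision[of p X])
  have Dc: "singular_chain (Suc p) X (D p m c)" if "singular_chain p X c" for p m c
    unfolding D_def by (intro singular_chain_sum Tc Sc that)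
  have DS: "chain_boundary (Suc p) (D p m c) + D (p - Suc 0) m (chain_boundary p c) = S p m c - c"
    if "singular_chain p X c" for p m c
  proof (induction m)
    case 0
    then show ?case by (simp add: D_def S_def)
  next
    case (Suc m)
    have *: "chain_boundary (Suc p) (T p (S p m c)) + T (p - Suc 0) (S (p - Suc 0) m (chain_boundary p c))
        = S p (Suc m) c - S p m c"
      using TS[OF Sc[OF that, of m]] Sb[OF that, of m] by (simp add: S_def)
    have "chain_boundary (Suc p) (D p (Suc m) c) + D (p - Suc 0) (Suc m) (chain_boundary p c) =
        (chain_boundary (Suc p) (D p m c) + D (p - Suc 0) m (chain_boundary p c)) +
        (chain_boundary (Suc p) (T p (S p m c)) + T (p - Suc 0) (S (p - Suc 0) m (chain_boundary p c)))"
      by (simp add: D_def chain_boundary_add)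
    then show ?case
      unfolding Suc.IH * by simp
  qed
  have "\<exists>m. \<forall>i\<ge>m. Poly_Mapping.keys (S p i (frag_of \<sigma>)) \<subseteq> Sm p"
    if \<sigma>: "singular_simplex p X \<sigma>" for p \<sigma>
  proof -
    have c: "singular_chain p X (frag_of \<sigma>)" using \<sigma> by (simp add: singular_chain_of)
    obtain m where m: "\<And>i f. m \<le> i \<Longrightarrow> f \<in> Poly_Mapping.keys (S p i (frag_of \<sigma>)) \<Longrightarrow>
        \<exists>V\<in>\<U>. f \<in> standard_simplex p \<rightarrow> V"
      unfolding S_def using sufficient_iterated_singular_subdivision_exists[OF U c] by blast
    have "f \<in> Sm p" if f: "m \<le> i" "f \<in> Poly_Mapping.keys (S p i (frag_of \<sigma>))" for i f
    proof -
      have "singular_simplex p X f"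
        using Sc[OF c, of i] f(2) by (auto simp: singular_chain_def)
      then show ?thesis
        using m[OF f] by (auto simp: Sm_def singular_simplex_subtopology image_subset_iff_funcset)
    qed
    then show ?thesis by blast
  qed
  then have "\<forall>p \<sigma>. \<exists>m. singular_simplex p X \<sigma> \<longrightarrow> (\<forall>i\<ge>m. Poly_Mapping.keys (S p i (frag_of \<sigma>)) \<subseteq> Sm p)"
    by blast
  then obtain m where m: "\<And>p \<sigma> i. singular_simplex p X \<sigma> \<Longrightarrow> m p \<sigma> \<le> i \<Longrightarrow>
      Poly_Mapping.keys (S p i (frag_of \<sigma>)) \<subseteq> Sm p"
    by metis
  have stable: "chain_eval (z (Suc p)) (D p M (frag_of \<sigma>)) = chain_eval (z (Suc p)) (D p (m p \<sigma>) (frag_of \<sigma>))"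
    if \<sigma>: "singular_simplex p X \<sigma>" and "m p \<sigma> \<le> M" for p \<sigma> M
    using that(2)
  proof (induction M rule: dec_induct)
    case (step M)
    \<comment> \<open>The summand that \<open>D\<close> gains is a chain of small simplices, where
      \<open>z\<close> vanishes. The double minus brings the sum into the form required by
      \<open>chain_eval_diff\<close>.\<close>
    have 0: "chain_eval (z (Suc p)) (- T p (S p M (frag_of \<sigma>))) = 0"
      using TSm[OF m[OF \<sigma> step(1)]] by (intro zSm) simp
    have "D p (Suc M) (frag_of \<sigma>) = D p M (frag_of \<sigma>) - - T p (S p M (frag_of \<sigma>))"
      by (simp add: D_def)
    then show ?case
      by (simp only: chain_eval_diff 0 step.IH) simp
  qed simp
  \<comment> \<open>The minus sign matches the homotopy formula \<open>DS\<close>, whose right-hand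
    side contains the chain itself negatively.\<close>
  define w where "w p \<tau> = (if singular_simplex p X \<tau>
    then - chain_eval (z (Suc p)) (D p (m p \<tau>) (frag_of \<tau>)) else 0)" for p \<tau>
  have "w \<in> cochains X"
  proof (rule cochainsI)
    show "{p. \<exists>\<tau>. w p \<tau> \<noteq> 0} \<subseteq> (\<lambda>n. n - 1) ` {n. \<exists>\<sigma>. z n \<sigma> \<noteq> 0}"
    proof
      fix p assume "p \<in> {p. \<exists>\<tau>. w p \<tau> \<noteq> 0}"
      then obtain \<tau> where "chain_eval (z (Suc p)) (D p (m p \<tau>) (frag_of \<tau>)) \<noteq> 0"
        by (auto simp: w_def split: if_splits)
      moreover have "chain_eval (z (Suc p)) c = 0" if "\<forall>\<sigma>. z (Suc p) \<sigma> = 0" for c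
        using that by (intro chain_eval_eq_0) simp
      ultimately have "\<exists>\<sigma>. z (Suc p) \<sigma> \<noteq> 0" by metis
      then show "p \<in> (\<lambda>n. n - 1) ` {n. \<exists>\<sigma>. z n \<sigma> \<noteq> 0}"
        by (intro image_eqI[of _ _ "Suc p"]) auto
    qed
  qed (use zc in \<open>auto simp: w_def finite_cochain_degrees\<close>)
  moreover have "coboundary X w n \<sigma> = z n \<sigma>" for n \<sigma>
  proof (cases "singular_simplex n X \<sigma>")
    case False
    then show ?thesis using zc by (simp add: coboundary_def cochain_outside)
  next
    case \<sigma>: True
    show ?thesis
    proof (cases n)
      case 0
      \<comment> \<open>The only point of the standard 0-simplex. A 0-simplex is a point, so it lies
        in a member of the cover and \<open>z\<close> vanishes on it.\<close>
      define e :: "nat \<Rightarrow> real" where "e = (\<lambda>j. if j = 0 then 1 else 0)"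
      have "\<sigma> e \<in> topspace X"
        using \<sigma> by (auto simp: singular_simplex_def 0 continuous_map_def standard_simplex_0 e_def)
      then obtain V where "V \<in> \<U>" "\<sigma> e \<in> V" using U(2) by blast
      then have "z n \<sigma> = 0"
        using \<sigma> by (intro small[of V]) (auto simp: singular_simplex_subtopology 0 standard_simplex_0 e_def)
      then show ?thesis by (simp add: 0)
    next
      case (Suc p)
      have c: "singular_chain (Suc p) X (frag_of \<sigma>)" using \<sigma> by (simp add: singular_chain_of Suc)
      have face: "singular_simplex p X (singular_face (Suc p) k \<sigma>)" if "k \<le> Suc p" for k
        using singular_simplex_singular_face[of "Suc p" X \<sigma> k] \<sigma> that by (simp add: Suc)
      \<comment> \<open>One index that is large enough for \<open>\<sigma>\<close> and all its
        faces; the sum bounds each of its finitely many terms.\<close>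
      define M where "M = m (Suc p) \<sigma> + (\<Sum>k\<le>Suc p. m p (singular_face (Suc p) k \<sigma>))"
      have M: "m p (singular_face (Suc p) k \<sigma>) \<le> M" if "k \<le> Suc p" for k
        using member_le_sum[of k "{..Suc p}" "\<lambda>k. m p (singular_face (Suc p) k \<sigma>)"] that
        by (simp add: M_def del: sum.atMost_Suc)
      let ?g = "\<lambda>c. chain_eval (z (Suc p)) (D p M c)"
      have "coboundary X w n \<sigma> = - (\<Sum>k\<le>Suc p. (- 1) ^ k * ?g (frag_of (singular_face (Suc p) k \<sigma>)))"
        using \<sigma> by (simp add: coboundary_def Suc w_def face stable[OF face M] sum_negf del: sum.atMost_Suc)
      also have "\<dots> = - ?g (chain_boundary (Suc p) (frag_of \<sigma>))"
        by (simp add: chain_boundary_of additive_alternating_sum[of ?g] Dd chain_eval_diff del: sum.atMost_Suc)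
      also have "D p M (chain_boundary (Suc p) (frag_of \<sigma>)) =
          S (Suc p) M (frag_of \<sigma>) - frag_of \<sigma> - chain_boundary (Suc (Suc p)) (D (Suc p) M (frag_of \<sigma>))"
        using DS[OF c, of M] by (simp add: algebra_simps)
      \<comment> \<open>The subdivided simplex is small, and on the boundary term \<open>z\<close>
        vanishes as a cocycle; only the middle term survives.\<close>
      also have "chain_eval (z (Suc p)) \<dots> = - z n \<sigma>"
        using zSm[OF m[of "Suc p" \<sigma> M]] \<sigma>
        by (simp add: chain_eval_diff chain_eval_boundary[OF Dc[OF c]] dz Suc M_def chain_eval_eq_0
            del: sum.atMost_Suc)
      finally show ?thesis by simp
    qed
  qed
  ultimately show ?thesis
    by (intro coboundariesI[of w]) (auto simp: fun_eq_iff)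
qed

section \<open>Products of cohomology classes\<close>

lemma cocycle_ring_simps [simp]:
  "mult (cocycle_ring X) = cup_product X"
  "one (cocycle_ring X) = unit_cochain X"
  "zero (cocycle_ring X) = (\<lambda>_ _. 0)"
  "add (cocycle_ring X) = (\<lambda>c d n \<sigma>. c n \<sigma> + d n \<sigma>)"
  by (simp_all add: cocycle_ring_def)

section \<open>Cohomology classes as cosets\<close>

lemma cocycle_iff:
  "c \<in> carrier (cocycle_ring X) \<longleftrightarrow> c \<in> cochains X \<and> coboundary X c = (\<lambda>_ _. 0)"
  by (simp add: cocycle_ring_def)

lemma zero_in_coboundaries: "(\<lambda>_ _. 0) \<in> coboundaries X"
  by (rule coboundariesI[OF cochains_zero]) simp

lemma coboundaries_add:
  assumes "c \<in> coboundaries X" "d \<in> coboundaries X"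
  shows "(\<lambda>n \<sigma>. c n \<sigma> + d n \<sigma>) \<in> coboundaries X"
  using assms unfolding coboundaries_def
  by (auto simp: coboundary_add[symmetric] intro!: imageI cochains_add)

lemma coboundaries_diff:
  assumes "c \<in> coboundaries X" "d \<in> coboundaries X"
  shows "(\<lambda>n \<sigma>. c n \<sigma> - d n \<sigma>) \<in> coboundaries X"
  using assms unfolding coboundaries_def
  by (auto simp: coboundary_diff[symmetric] intro!: imageI cochains_diff)

text \<open>Turns cosets into congruence modulo coboundaries, so that equality of classes can be
  read off from a difference.\<close>

lemma coset_altdef:
  "coboundaries X +>\<^bsub>cocycle_ring X\<^esub> c = {e. (\<lambda>n \<sigma>. e n \<sigma> - c n \<sigma>) \<in> coboundaries X}"
proof (intro equalityI subsetI)
  fix e assume "e \<in> {e. (\<lambda>n \<sigma>. e n \<sigma> - c n \<sigma>) \<in> coboundaries X}"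
  then show "e \<in> coboundaries X +>\<^bsub>cocycle_ring X\<^esub> c"
    unfolding a_r_coset_def' by (auto intro!: bexI[of _ "\<lambda>n \<sigma>. e n \<sigma> - c n \<sigma>"])
qed (auto simp: a_r_coset_def')

lemma coset_eqI:
  assumes "(\<lambda>n \<sigma>. c n \<sigma> - d n \<sigma>) \<in> coboundaries X"
  shows "coboundaries X +>\<^bsub>cocycle_ring X\<^esub> c = coboundaries X +>\<^bsub>cocycle_ring X\<^esub> d"
  using coboundaries_add[OF _ assms] coboundaries_diff[OF _ assms]
  by (fastforce simp: coset_altdef)

lemma coset_eq_coboundaries:
  assumes "c \<in> coboundaries X"
  shows "coboundaries X +>\<^bsub>cocycle_ring X\<^esub> c = coboundaries X"
  using coset_eqI[of c "\<lambda>_ _. 0" X] assms by (simp add: coset_altdef)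

lemma coboundaries_cocycle: "c \<in> coboundaries X \<Longrightarrow> c \<in> carrier (cocycle_ring X)"
  by (auto simp: coboundaries_def cocycle_iff coboundary_in_cochains coboundary_coboundary)

section \<open>Coboundaries as an ideal of the cocycles\<close>

lemma cup_product_cocycle:
  assumes "c \<in> carrier (cocycle_ring X)" "d \<in> carrier (cocycle_ring X)"
  shows "cup_product X c d \<in> carrier (cocycle_ring X)"
  using assms by (auto simp: cocycle_iff cup_product_in_cochains coboundary_cup_product)

lemma unit_cochain_cocycle: "unit_cochain X \<in> carrier (cocycle_ring X)"
proof -
  have "unit_cochain X \<in> cochains X"
    by (rule cochainsI[where N = "{0}"]) (auto simp: unit_cochain_def)
  moreover have "coboundary X (unit_cochain X) n \<sigma> = 0" for n \<sigma>
  \<comment> \<open>In degree 1 the two end points contribute 1 and -1; in all other degrees every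
    term is zero.\<close>
  proof (cases "n = 1")
    case True
    then show ?thesis
      using singular_simplex_singular_face[of 1 X \<sigma> 0] singular_simplex_singular_face[of 1 X \<sigma> 1]
      by (auto simp: coboundary_def unit_cochain_def)
  qed (auto simp: coboundary_def unit_cochain_def intro!: sum.neutral)
  ultimately show ?thesis
    by (auto simp: cocycle_iff)
qed

text \<open>If \<open>u\<close> is a primitive of \<open>c\<close>, then
  \<open>cup_product X u d\<close> is one of the product: the other Leibniz term contains the
  coboundary of \<open>d\<close>.\<close>

lemma cup_product_coboundary_left:
  assumes "c \<in> coboundaries X" "d \<in> carrier (cocycle_ring X)"
  shows "cup_product X c d \<in> coboundaries X"
proof -
  obtain u where u: "u \<in> cochains X" "c = coboundary X u"
    using assms(1) by (auto simp: coboundaries_def)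
  show ?thesis
    by (rule coboundariesI[of "cup_product X u d"])
      (use u assms(2) in \<open>auto simp: cocycle_iff coboundary_cup_product cup_product_in_cochains\<close>)
qed

lemma cup_product_coboundary_right:
  assumes "c \<in> carrier (cocycle_ring X)" "d \<in> coboundaries X"
  shows "cup_product X c d \<in> coboundaries X"
proof -
  obtain v where v: "v \<in> cochains X" "d = coboundary X v"
    using assms(2) by (auto simp: coboundaries_def)
  \<comment> \<open>The primitive uses the sign-twisted \<open>c\<close>, so that the sign in the
    Leibniz rule cancels.\<close>
  have "(\<lambda>n \<sigma>. (- 1) ^ n * ((- 1) ^ n * c n \<sigma>)) = c"
    by (simp add: fun_eq_iff flip: mult.assoc power_add)
  then show ?thesis
    using v assms(1)
    by (intro coboundariesI[of "cup_product X (\<lambda>n \<sigma>. (- 1) ^ n * c n \<sigma>) v"])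
      (auto simp: cocycle_iff coboundary_cup_product cup_product_in_cochains cochains_mult_left
        coboundary_alternating)
qed

text \<open>The quotient ring multiplies cosets by a union over all pairs of representatives. It
  collapses to one coset because the class of the product does not depend on the pair.\<close>

lemma mult_cosets:
  assumes "c \<in> carrier (cocycle_ring X)" "d \<in> carrier (cocycle_ring X)"
  shows "(coboundaries X +>\<^bsub>cocycle_ring X\<^esub> c) \<otimes>\<^bsub>cohomology_ring X\<^esub> (coboundaries X +>\<^bsub>cocycle_ring X\<^esub> d)
       = coboundaries X +>\<^bsub>cocycle_ring X\<^esub> cup_product X c d"
proof -
  let ?I = "coboundaries X"
  have *: "?I +>\<^bsub>cocycle_ring X\<^esub> cup_product X c' d' = ?I +>\<^bsub>cocycle_ring X\<^esub> cup_product X c d"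
    if c'I: "c' \<in> ?I +>\<^bsub>cocycle_ring X\<^esub> c" and d'I: "d' \<in> ?I +>\<^bsub>cocycle_ring X\<^esub> d" for c' d'
  proof (rule coset_eqI)
    obtain x y where x: "x \<in> ?I" and y: "y \<in> ?I"
      and c': "c' = (\<lambda>n \<sigma>. x n \<sigma> + c n \<sigma>)" and d': "d' = (\<lambda>n \<sigma>. y n \<sigma> + d n \<sigma>)"
      using c'I d'I by (auto simp: a_r_coset_def')
    have "d' \<in> carrier (cocycle_ring X)"
      unfolding d' using coboundaries_cocycle[OF y] assms(2)
      by (auto simp: cocycle_iff coboundary_add cochains_add)
    \<comment> \<open>The representatives are changed one at a time, so each summand pairs a
      coboundary with a cocycle.\<close>
    then have "(\<lambda>n \<sigma>. cup_product X x d' n \<sigma> + cup_product X c y n \<sigma>) \<in> ?I"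
      using x y assms(1)
      by (intro coboundaries_add cup_product_coboundary_left cup_product_coboundary_right)
    moreover have "cup_product X c' d' n \<sigma> - cup_product X c d n \<sigma> = cup_product X x d' n \<sigma> + cup_product X c y n \<sigma>"
      for n \<sigma>
      unfolding c' cup_product_add_left d' cup_product_add_right by simp
    ultimately show "(\<lambda>n \<sigma>. cup_product X c' d' n \<sigma> - cup_product X c d n \<sigma>) \<in> ?I"
      by simp
  qed
  have **: "c \<in> ?I +>\<^bsub>cocycle_ring X\<^esub> c" "d \<in> ?I +>\<^bsub>cocycle_ring X\<^esub> d"
    by (simp_all add: coset_altdef zero_in_coboundaries)
  have "(?I +>\<^bsub>cocycle_ring X\<^esub> c) \<otimes>\<^bsub>cohomology_ring X\<^esub> (?I +>\<^bsub>cocycle_ring X\<^esub> d) =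
      (\<Union>a \<in> ?I +>\<^bsub>cocycle_ring X\<^esub> c. \<Union>b \<in> ?I +>\<^bsub>cocycle_ring X\<^esub> d. ?I +>\<^bsub>cocycle_ring X\<^esub> cup_product X a b)"
    by (simp add: cohomology_ring_def FactRing_def rcoset_mult_def)
  also have "\<dots> = ?I +>\<^bsub>cocycle_ring X\<^esub> cup_product X c d"
    by (intro UN_constant_eq[OF **(1)] UN_constant_eq[OF **(2)] ballI *)
  finally show ?thesis .
qed

section \<open>Null-homotopic maps\<close>

text \<open>The cone over a simplex \<open>\<sigma>\<close> with respect to a homotopy \<open>h\<close> that ends at the constant \<open>y\<close>.
  The new vertex is the \<open>0\<close>th one, and its barycentric coordinate is the time of the homotopy.\<close>

definition homotopy_cone ::
    "(real \<times> 'a \<Rightarrow> 'b) \<Rightarrow> 'b \<Rightarrow> nat \<Rightarrow> ((nat \<Rightarrow> real) \<Rightarrow> 'a) \<Rightarrow> (nat \<Rightarrow> real) \<Rightarrow> 'b" where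
  "homotopy_cone h y p \<sigma> = (\<lambda>x \<in> standard_simplex (Suc p).
     if x 0 = 1 then y else h (x 0, \<sigma> (\<lambda>i. x (Suc i) / (1 - x 0))))"

text \<open>This is the projection from vertex 0 onto the opposite face, defined away from that
  vertex.\<close>

lemma standard_simplex_rescale:
  assumes x: "x \<in> standard_simplex (Suc p)" and "x 0 \<noteq> 1"
  shows "(\<lambda>i. x (Suc i) / (1 - x 0)) \<in> standard_simplex p"
proof -
  have nn: "\<And>i. 0 \<le> x i" and z: "\<And>i. i > Suc p \<Longrightarrow> x i = 0" and le1: "x 0 \<le> 1"
    and s: "(\<Sum>i\<le>Suc p. x i) = 1"
    using x by (auto simp: standard_simplex_def)
  have pos: "0 < 1 - x 0" using le1 assms(2) by simp
  have s': "(\<Sum>i\<le>p. x (Suc i)) = 1 - x 0"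
    using s by (simp add: sum.atMost_Suc_shift del: sum.atMost_Suc)
  have "x (Suc i) \<le> 1 - x 0" for i
  proof (cases "i \<le> p")
    case True
    then show ?thesis using member_le_sum[of i "{..p}" "\<lambda>i. x (Suc i)"] nn s' by simp
  qed (use z pos in auto)
  then show ?thesis
    using nn z pos s' by (auto simp: standard_simplex_def divide_simps simp flip: sum_divide_distrib)
qed

lemma standard_simplex_cone:
  assumes x: "x \<in> standard_simplex p" and t: "0 \<le> t" "t \<le> 1"
  shows "(\<lambda>i. case i of 0 \<Rightarrow> t | Suc j \<Rightarrow> (1 - t) * x j) \<in> standard_simplex (Suc p)"
proof -
  have "0 \<le> (1 - t) * x j" "(1 - t) * x j \<le> 1" for j
    using x t by (auto simp: standard_simplex_def intro: mult_le_one)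
  moreover have "(\<Sum>i\<le>p. (1 - t) * x i) = 1 - t"
    using x by (simp add: standard_simplex_def flip: sum_distrib_left)
  ultimately show ?thesis
    using x t by (auto simp: standard_simplex_def sum.atMost_Suc_shift split: nat.split simp del: sum.atMost_Suc)
qed

text \<open>Continuity at the cone vertex holds since the standard simplex is a quotient of
  the compact cylinder over its \<open>0\<close>th face.\<close>

lemma singular_simplex_homotopy_cone:
  assumes h: "continuous_map (prod_topology (top_of_set {0..1}) X) Y h"
    and h1: "\<And>x. x \<in> topspace X \<Longrightarrow> h (1, x) = y"
    and \<sigma>: "singular_simplex p X \<sigma>"
  shows "singular_simplex (Suc p) Y (homotopy_cone h y p \<sigma>)"
proof -
  let ?D = "\<lambda>p. subtopology (powertop_real UNIV) (standard_simplex p)"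
  let ?C = "prod_topology (top_of_set {0..1::real}) (?D p)"
  \<comment> \<open>The cylinder maps onto the cone by joining each point to vertex 0; the end
    \<open>t = 1\<close> collapses to that vertex.\<close>
  define q :: "real \<times> (nat \<Rightarrow> real) \<Rightarrow> nat \<Rightarrow> real"
    where "q = (\<lambda>(t, x) i. case i of 0 \<Rightarrow> t | Suc j \<Rightarrow> (1 - t) * x j)"
  have t: "continuous_map ?C euclideanreal fst"
    using continuous_map_fst continuous_map_in_subtopology by blast
  have x: "continuous_map ?C (powertop_real UNIV) snd"
    using continuous_map_snd continuous_map_in_subtopology by blast
  have xj: "continuous_map ?C euclideanreal (\<lambda>z. snd z j)" for j
    using continuous_map_compose[OF x continuous_map_product_projection[of j UNIV "\<lambda>_. euclideanreal"]]
    by (simp add: o_def)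
  have "continuous_map ?C euclideanreal (\<lambda>z. q z i)" for i
    by (cases i) (auto simp: q_def case_prod_beta intro!: continuous_intros t xj)
  then have "continuous_map ?C (powertop_real UNIV) q"
    by (simp add: continuous_map_componentwise_UNIV)
  moreover have qin: "q z \<in> standard_simplex (Suc p)" if "z \<in> {0..1} \<times> standard_simplex p" for z
    using that standard_simplex_cone[of "snd z" p "fst z"] by (auto simp: q_def)
  ultimately have qc: "continuous_map ?C (?D (Suc p)) q"
    by (auto simp: continuous_map_in_subtopology)
  have qsurj: "q ` topspace ?C = topspace (?D (Suc p))"
  proof
    show "topspace (?D (Suc p)) \<subseteq> q ` topspace ?C"
    proof
      fix x assume "x \<in> topspace (?D (Suc p))"
      then have x: "x \<in> standard_simplex (Suc p)" by simp
      then have x0: "x 0 \<in> {0..1}" by (simp add: standard_simplex_def)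
      show "x \<in> q ` topspace ?C"
      proof (cases "x 0 = 1")
        case False
        have "x = q (x 0, \<lambda>i. x (Suc i) / (1 - x 0))"
          using False by (auto simp: q_def split: nat.split)
        then show ?thesis
          using standard_simplex_rescale[OF x False] x0 by (intro image_eqI) auto
      next
        case True
        \<comment> \<open>At the vertex all other coordinates vanish, and any point \<open>e\<close>
          gives a preimage.\<close>
        have "(\<Sum>i\<le>p. x (Suc i)) = 0"
          using x True by (simp add: standard_simplex_def sum.atMost_Suc_shift del: sum.atMost_Suc)
        then have "x (Suc i) = 0" for i
          using x by (cases "i \<le> p") (auto simp: standard_simplex_def sum_nonneg_eq_0_iff)
        moreover obtain e where "e \<in> standard_simplex p" using nonempty_standard_simplex by blast
        ultimately show ?thesis
          using True by (intro image_eqI[of _ _ "(1, e)"]) (auto simp: q_def split: nat.split)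
      qed
    qed
  qed (use qin in auto)
  have "compact_space ?C"
    by (simp add: compact_space_prod_topology compact_space_subtopology compactin_standard_simplex)
  moreover have "Hausdorff_space (?D (Suc p))"
    by (simp add: Hausdorff_space_subtopology Hausdorff_space_product_topology)
  ultimately have quot: "quotient_map ?C (?D (Suc p)) q"
    using qc qsurj by (simp add: continuous_imp_quotient_map)
  have \<sigma>c: "continuous_map (?D p) X \<sigma>" using \<sigma> by (simp add: singular_simplex_def)
  have "continuous_map ?C Y (h \<circ> (\<lambda>(t, x). (t, \<sigma> x)))"
    by (rule continuous_map_compose[OF _ h]) (simp add: continuous_map_prod_top \<sigma>c)
  \<comment> \<open>For \<open>t \<noteq> 1\<close> the rescaling recovers \<open>x\<close>; for
    \<open>t = 1\<close> both sides equal \<open>y\<close>.\<close>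
  moreover have "(h \<circ> (\<lambda>(t, x). (t, \<sigma> x))) z = (homotopy_cone h y p \<sigma> \<circ> q) z" if zC: "z \<in> topspace ?C" for z
  proof -
    obtain t x where z: "z = (t, x)" "x \<in> standard_simplex p" using zC by (cases z) auto
    have "(\<lambda>i. q (t, x) (Suc i) / (1 - q (t, x) 0)) = x" if "t \<noteq> 1"
      using that by (simp add: q_def)
    moreover have "\<sigma> x \<in> topspace X"
      using \<sigma>c z by (auto simp: continuous_map_def)
    ultimately show ?thesis
      using qin[of z] zC z h1 by (auto simp: homotopy_cone_def q_def)
  qed
  ultimately have "continuous_map ?C Y (homotopy_cone h y p \<sigma> \<circ> q)"
    by (rule continuous_map_eq)
  then have "continuous_map (?D (Suc p)) Y (homotopy_cone h y p \<sigma>)"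
    by (rule continuous_compose_quotient_map[OF quot])
  moreover have "homotopy_cone h y p \<sigma> \<in> extensional (standard_simplex (Suc p))"
    by (simp add: homotopy_cone_def)
  ultimately show ?thesis
    by (simp add: singular_simplex_def)
qed

text \<open>The 0th face is the base of the cone, at time 0 of the homotopy.\<close>

lemma singular_face_0_homotopy_cone:
  assumes "\<And>x. x \<in> topspace X \<Longrightarrow> h (0, x) = f x" and \<sigma>: "singular_simplex p X \<sigma>"
  shows "singular_face (Suc p) 0 (homotopy_cone h y p \<sigma>) = simplex_map p f \<sigma>"
proof -
  have "\<sigma> x \<in> topspace X" if "x \<in> standard_simplex p" for x
    using \<sigma> that by (auto simp: singular_simplex_def continuous_map_def)
  then show ?thesis
    using simplical_face_in_standard_simplex[of "Suc p" 0] assms(1)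
    by (auto simp: singular_face_def homotopy_cone_def simplex_map_def simplical_face_def intro!: ext)
qed

text \<open>A face map with positive index leaves the time coordinate alone and commutes with the
  rescaling of the others.\<close>

lemma singular_face_Suc_homotopy_cone:
  assumes "k \<le> Suc p"
  shows "singular_face (Suc (Suc p)) (Suc k) (homotopy_cone h y (Suc p) \<sigma>)
       = homotopy_cone h y p (singular_face (Suc p) k \<sigma>)"
proof (rule ext)
  fix x :: "nat \<Rightarrow> real"
  have "(\<lambda>i. simplical_face (Suc k) x (Suc i) / (1 - simplical_face (Suc k) x 0)) =
      simplical_face k (\<lambda>i. x (Suc i) / (1 - x 0))"
  proof
    show "simplical_face (Suc k) x (Suc i) / (1 - simplical_face (Suc k) x 0) =
      simplical_face k (\<lambda>i. x (Suc i) / (1 - x 0)) i" for i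
      by (cases i) (auto simp: simplical_face_def)
  qed
  moreover have "simplical_face (Suc k) x 0 = x 0"
    by (simp add: simplical_face_def)
  moreover have "simplical_face (Suc k) x \<in> standard_simplex (Suc (Suc p))" if "x \<in> standard_simplex (Suc p)"
    using simplical_face_in_standard_simplex[of "Suc (Suc p)" "Suc k"] that assms by simp
  ultimately show "singular_face (Suc (Suc p)) (Suc k) (homotopy_cone h y (Suc p) \<sigma>) x
       = homotopy_cone h y p (singular_face (Suc p) k \<sigma>) x"
    using standard_simplex_rescale[of x p]
    by (auto simp: singular_face_def homotopy_cone_def)
qed

text \<open>The primitive evaluates \<open>z\<close> on cones. The assumption on degree 0 reflects
  that coboundaries vanish there, so a nonzero constant could not be reached.\<close>

lemma null_homotopic_pullback_coboundary:
  fixes z :: "('b, 'k::field) cochain"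
  assumes "null_homotopic X Y f" and z: "z \<in> carrier (cocycle_ring Y)" and z0: "\<And>\<sigma>. z 0 \<sigma> = 0"
  obtains w where "w \<in> cochains X"
    "\<And>n \<sigma>. singular_simplex n X \<sigma> \<Longrightarrow> coboundary X w n \<sigma> = z n (simplex_map n f \<sigma>)"
proof -
  have zc: "z \<in> cochains Y" and dz: "coboundary Y z = (\<lambda>_ _. 0)"
    using z by (auto simp: cocycle_ring_def)
  obtain y h where h: "continuous_map (prod_topology (top_of_set {0..1::real}) X) Y h"
    and h01: "\<forall>x. h (0, x) = f x" "\<forall>x. h (1, x) = y"
    using assms(1) unfolding null_homotopic_def homotopic_with_def by blast
  have h0: "h (0, x) = f x" and h1: "h (1, x) = y" for x
    using h01 by auto
  note cone = singular_simplex_homotopy_cone[OF h h1]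
  define w where "w p \<tau> = (if singular_simplex p X \<tau> then z (Suc p) (homotopy_cone h y p \<tau>) else 0)" for p \<tau>
  have "w \<in> cochains X"
  proof (rule cochainsI)
    show "{p. \<exists>\<tau>. w p \<tau> \<noteq> 0} \<subseteq> (\<lambda>n. n - 1) ` {n. \<exists>\<sigma>. z n \<sigma> \<noteq> 0}"
      by (force simp: w_def split: if_splits)
  qed (use zc in \<open>auto simp: w_def finite_cochain_degrees\<close>)
  moreover have "coboundary X w n \<sigma> = z n (simplex_map n f \<sigma>)" if \<sigma>: "singular_simplex n X \<sigma>" for n \<sigma>
  proof (cases n)
    case 0
    then show ?thesis by (simp add: z0)
  next
    case (Suc p)
    have face: "singular_simplex p X (singular_face (Suc p) k \<sigma>)" if "k \<le> Suc p" for k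
      using singular_simplex_singular_face[of "Suc p" X \<sigma> k] \<sigma> that by (simp add: Suc)
    \<comment> \<open>The cocycle condition on the cone over \<open>\<sigma>\<close>: the base gives
      the pullback of \<open>z\<close>, and the other faces, being cones over the faces of
      \<open>\<sigma>\<close>, give the coboundary of \<open>w\<close> with opposite sign.\<close>
    have "0 = coboundary Y z (Suc n) (homotopy_cone h y n \<sigma>)"
      by (simp add: dz)
    also have "\<dots> = z n (simplex_map n f \<sigma>)
        - (\<Sum>k\<le>n. (- 1) ^ k * z n (singular_face (Suc n) (Suc k) (homotopy_cone h y n \<sigma>)))"
      using cone[OF \<sigma>] singular_face_0_homotopy_cone[of X h f, OF h0 \<sigma>]
      by (simp add: coboundary_def sum.atMost_Suc_shift sum_negf del: sum.atMost_Suc)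
    also have "(\<Sum>k\<le>n. (- 1) ^ k * z n (singular_face (Suc n) (Suc k) (homotopy_cone h y n \<sigma>)))
        = coboundary X w n \<sigma>"
      using \<sigma> by (simp add: coboundary_def Suc w_def face singular_face_Suc_homotopy_cone del: sum.atMost_Suc)
    finally show ?thesis by simp
  qed
  ultimately show ?thesis by (rule that)
qed

section \<open>Cup-length and category\<close>

lemma cochain_map_in_cochains:
  assumes "c \<in> cochains Y"
  shows "cochain_map X f c \<in> cochains X"
  by (rule cochainsI[where N = "{n. \<exists>\<sigma>. c n \<sigma> \<noteq> 0}"])
    (use assms in \<open>auto simp: cochain_map_def finite_cochain_degrees\<close>)

lemma coboundary_cochain_map:
  assumes f: "continuous_map X Y f"
  shows "coboundary X (cochain_map X f c) = cochain_map X f (coboundary Y c)"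
proof (intro ext)
  fix n \<sigma>
  show "coboundary X (cochain_map X f c) n \<sigma> = cochain_map X f (coboundary Y c) n \<sigma>"
  proof (cases "0 < n \<and> singular_simplex n X \<sigma>")
    case True
    have "simplex_map (n - 1) f (singular_face n k \<sigma>) = singular_face n k (simplex_map n f \<sigma>)" if "k \<le> n" for k
      using True that
      by (simp add: singular_face_simplex_map) (auto simp: simplex_map_def singular_face_def intro!: ext)
    then have "cochain_map X f c (n - 1) (singular_face n k \<sigma>) =
        c (n - 1) (singular_face n k (simplex_map n f \<sigma>))" if "k \<le> n" for k
      using that True singular_simplex_singular_face[of n X \<sigma> k]
      by (simp add: cochain_map_def)
    then show ?thesis
      using True singular_simplex_simplex_map[OF _ f] by (simp add: coboundary_def cochain_map_def)
  qed (auto simp: coboundary_def cochain_map_def)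
qed

text \<open>Pullback commutes with the coboundary, so the class of \<open>z\<close> lands inside the
  class of its pullback; adding \<open>coboundaries X\<close> fills up that class.\<close>

lemma cohomology_map_coset:
  assumes f: "continuous_map X Y f"
  shows "cohomology_map X f (coboundaries Y +>\<^bsub>cocycle_ring Y\<^esub> z)
    = coboundaries X +>\<^bsub>cocycle_ring X\<^esub> cochain_map X f z"
proof -
  have add: "cochain_map X f (\<lambda>n \<sigma>. e n \<sigma> + z n \<sigma>) = (\<lambda>n \<sigma>. cochain_map X f e n \<sigma> + cochain_map X f z n \<sigma>)" for e
    by (auto simp: cochain_map_def fun_eq_iff)
  have "cochain_map X f e \<in> coboundaries X" if "e \<in> coboundaries Y" for e
    using that coboundary_cochain_map[OF f] cochain_map_in_cochains
    unfolding coboundaries_def by (metis (no_types, lifting) image_iff)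
  then have "(\<lambda>n \<sigma>. d n \<sigma> + cochain_map X f e n \<sigma>) \<in> coboundaries X"
    if "d \<in> coboundaries X" "e \<in> coboundaries Y" for d e
    using that coboundaries_add by blast
  then have "(\<lambda>n \<sigma>. d n \<sigma> + cochain_map X f e n \<sigma>) \<in> coboundaries X +>\<^bsub>cocycle_ring X\<^esub> cochain_map X f z"
    if "d \<in> coboundaries X" "e \<in> coboundaries Y +>\<^bsub>cocycle_ring Y\<^esub> z" for d e
    using that by (fastforce simp: a_r_coset_def' add add.assoc)
  moreover have "e \<in> cohomology_map X f (coboundaries Y +>\<^bsub>cocycle_ring Y\<^esub> z)"
    if e: "e \<in> coboundaries X +>\<^bsub>cocycle_ring X\<^esub> cochain_map X f z" for e
  proof -
    have "z \<in> coboundaries Y +>\<^bsub>cocycle_ring Y\<^esub> z"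
      by (simp add: coset_altdef zero_in_coboundaries)
    with e show ?thesis
      by (auto simp: cohomology_map_def set_add_def' a_r_coset_def'[of "cocycle_ring X"])
  qed
  ultimately show ?thesis
    by (auto simp: cohomology_map_def set_add_def')
qed

text \<open>On \<open>U\<close> the pulled-back cocycle has a primitive, and subtracting its
  coboundary on all of \<open>X\<close> changes the representative but not the class.\<close>

lemma image_class_representative:
  fixes x :: "('a, 'k::field) cochain set"
  assumes f: "continuous_map X Y f" and U: "null_homotopic (subtopology X U) Y f"
    and x: "x \<in> image_group X Y f p" "0 < p"
  obtains z where "z \<in> carrier (cocycle_ring X)" "x = coboundaries X +>\<^bsub>cocycle_ring X\<^esub> z"
    "\<And>n \<sigma>. singular_simplex n (subtopology X U) \<sigma> \<Longrightarrow> z n \<sigma> = 0"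
proof -
  obtain y where y: "y \<in> carrier (cocycle_ring Y)" "in_degree p y"
    and "x = cohomology_map X f (coboundaries Y +>\<^bsub>cocycle_ring Y\<^esub> y)"
    using x by (auto simp: image_group_def cohomology_group_def)
  then have xy: "x = coboundaries X +>\<^bsub>cocycle_ring X\<^esub> cochain_map X f y"
    using cohomology_map_coset[OF f] by simp
  have "y 0 \<sigma> = 0" for \<sigma>
    using y(2) x(2) by (simp add: in_degree_def)
  then obtain w where w: "w \<in> cochains (subtopology X U)" and
    dw: "\<And>n \<sigma>. singular_simplex n (subtopology X U) \<sigma> \<Longrightarrow>
      coboundary (subtopology X U) w n \<sigma> = y n (simplex_map n f \<sigma>)"
    using null_homotopic_pullback_coboundary[OF U y(1)] by blast
  \<comment> \<open>Cochains are zero off the simplices of their space, so \<open>w\<close> is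
    already its own extension by zero.\<close>
  have wX: "w \<in> cochains X"
    using w by (auto simp: cochains_def singular_simplex_subtopology)
  define z where "z n \<sigma> = cochain_map X f y n \<sigma> - coboundary X w n \<sigma>" for n \<sigma>
  have "cochain_map X f y \<in> carrier (cocycle_ring X)"
    using y(1)
    by (auto simp: cocycle_iff cochain_map_in_cochains coboundary_cochain_map[OF f])
      (auto simp: cochain_map_def fun_eq_iff)
  then have "z \<in> carrier (cocycle_ring X)"
    using wX unfolding z_def
    by (auto simp: cocycle_iff coboundary_diff coboundary_coboundary cochains_diff coboundary_in_cochains)
  moreover have "x = coboundaries X +>\<^bsub>cocycle_ring X\<^esub> z"
    unfolding xy by (rule coset_eqI, rule coboundariesI[OF wX]) (simp add: z_def fun_eq_iff)
  moreover have "z n \<sigma> = 0" if \<sigma>: "singular_simplex n (subtopology X U) \<sigma>" for n \<sigma>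
  proof -
    have "coboundary X w n \<sigma> = coboundary (subtopology X U) w n \<sigma>"
      using \<sigma> by (auto simp: coboundary_def singular_simplex_subtopology)
    then show ?thesis
      using dw[OF \<sigma>] \<sigma> by (simp add: z_def cochain_map_def singular_simplex_subtopology)
  qed
  ultimately show ?thesis by (rule that)
qed

text \<open>Front and back faces of a simplex in \<open>U\<close> stay in \<open>U\<close>, so every
  summand has a zero factor.\<close>

lemma cup_product_vanishes:
  assumes "singular_simplex n (subtopology X U) \<sigma>"
    and "(\<forall>n \<sigma>. singular_simplex n (subtopology X U) \<sigma> \<longrightarrow> c n \<sigma> = 0) \<or>
         (\<forall>n \<sigma>. singular_simplex n (subtopology X U) \<sigma> \<longrightarrow> d n \<sigma> = 0)"
  shows "cup_product X c d n \<sigma> = 0"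
proof -
  have "singular_simplex p (subtopology X U) (front_face p \<sigma>)"
       "singular_simplex (n - p) (subtopology X U) (back_face p (n - p) \<sigma>)" if "p \<le> n" for p
    using singular_simplex_front_face[OF assms(1) that] singular_simplex_back_face[of p "n - p"] assms(1) that
    by auto
  then show ?thesis
    using assms(2) by (auto simp: cup_product_def)
qed

text \<open>The factor at position \<open>i\<close> is represented by a cocycle that vanishes on
  \<open>U i\<close>, and the product inherits all these vanishing properties. The sequence
  \<open>U\<close> is generalized because the tail of the list uses it shifted by one.\<close>

lemma image_product_representative:
  fixes xs :: "('a, 'k::field) cochain set list"
  assumes f: "continuous_map X Y f"
    and "\<And>i. null_homotopic (subtopology X (U i)) Y f"
    and "\<forall>x \<in> set xs. \<exists>p>0. x \<in> image_group X Y f p"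
  shows "\<exists>z \<in> carrier (cocycle_ring X).
     foldr (mult (image_ring X Y f)) xs \<one>\<^bsub>image_ring X Y f\<^esub> = coboundaries X +>\<^bsub>cocycle_ring X\<^esub> z \<and>
     (\<forall>i < length xs. \<forall>n \<sigma>. singular_simplex n (subtopology X (U i)) \<sigma> \<longrightarrow> z n \<sigma> = 0)"
  using assms(2,3)
proof (induction xs arbitrary: U)
  case Nil
  show ?case
    by (rule bexI[OF _ unit_cochain_cocycle])
      (simp add: image_ring_def cohomology_ring_def FactRing_def)
next
  case (Cons x xs)
  obtain d where d: "d \<in> carrier (cocycle_ring X)"
    "foldr (mult (image_ring X Y f)) xs \<one>\<^bsub>image_ring X Y f\<^esub> = coboundaries X +>\<^bsub>cocycle_ring X\<^esub> d"
    "\<forall>i < length xs. \<forall>n \<sigma>. singular_simplex n (subtopology X (U (Suc i))) \<sigma> \<longrightarrow> d n \<sigma> = 0"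
    using Cons.IH[of "\<lambda>i. U (Suc i)"] Cons.prems by auto
  obtain p where p: "0 < p" "x \<in> image_group X Y f p"
    using Cons.prems by auto
  obtain c where c: "c \<in> carrier (cocycle_ring X)" "x = coboundaries X +>\<^bsub>cocycle_ring X\<^esub> c"
    "\<And>n \<sigma>. singular_simplex n (subtopology X (U 0)) \<sigma> \<Longrightarrow> c n \<sigma> = 0"
    using image_class_representative[OF f Cons.prems(1)[of 0] p(2,1)] by blast
  have mult: "mult (image_ring X Y f) = mult (cohomology_ring X)"
    by (simp add: image_ring_def)
  have "foldr (mult (image_ring X Y f)) (x # xs) \<one>\<^bsub>image_ring X Y f\<^esub> =
      coboundaries X +>\<^bsub>cocycle_ring X\<^esub> cup_product X c d"
    using d(2) mult_cosets[OF c(1) d(1)] by (simp add: c(2) mult)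
  moreover have "cup_product X c d n \<sigma> = 0"
    if "i < length (x # xs)" "singular_simplex n (subtopology X (U i)) \<sigma>" for i n \<sigma>
    using that c(3) d(3) by (intro cup_product_vanishes[OF that(2)]) (cases i; auto)
  ultimately show ?case
    using cup_product_cocycle[OF c(1) d(1)] by blast
qed

lemma cup_length_le_LS_cat:
  assumes f: "continuous_map X Y f"
  shows "len (image_ring X Y f :: ('a, 'k::field) cochain set ring) (image_group X Y f) \<le> LS_cat X Y f"
  unfolding len_def LS_cat_def
\<comment> \<open>It suffices to compare a single nonzero product with a single cover; infinite
  values are covered as well.\<close>
proof (intro Sup_least Inf_greatest, clarify)
  fix xs :: "('a, 'k) cochain set list" and n and U :: "nat \<Rightarrow> 'a set"
  assume xs: "\<forall>x \<in> set xs. \<exists>p>0. x \<in> image_group X Y f p"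
    and nz: "foldr (mult (image_ring X Y f)) xs \<one>\<^bsub>image_ring X Y f\<^esub> \<noteq> \<zero>\<^bsub>image_ring X Y f\<^esub>"
    and U: "\<forall>i\<le>n. openin X (U i) \<and> null_homotopic (subtopology X (U i)) Y f"
    and cover: "(\<Union>i\<le>n. U i) = topspace X"
  \<comment> \<open>The list may be longer than the cover, which is therefore padded with empty
    sets.\<close>
  define V where "V i = (if i \<le> n then U i else {})" for i
  have V: "null_homotopic (subtopology X (V i)) Y f" for i
    using U null_homotopic_empty[of X Y f] by (simp add: V_def)
  obtain z where z: "z \<in> carrier (cocycle_ring X)"
    "foldr (mult (image_ring X Y f)) xs \<one>\<^bsub>image_ring X Y f\<^esub> = coboundaries X +>\<^bsub>cocycle_ring X\<^esub> z"
    "\<And>i n \<sigma>. i < length xs \<Longrightarrow> singular_simplex n (subtopology X (V i)) \<sigma> \<Longrightarrow> z n \<sigma> = 0"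
    using image_product_representative[of X Y f V xs, OF f V xs] by blast
  show "enat (length xs) \<le> enat n"
  proof (rule ccontr)
    assume "\<not> enat (length xs) \<le> enat n"
    \<comment> \<open>There are at least \<open>n + 1\<close> factors, so each of the
      \<open>n + 1\<close> open sets has a factor of its own.\<close>
    then have len: "n < length xs" by simp
    have "z \<in> coboundaries X"
    proof (rule coboundaries_if_vanishes_on_small[OF z(1), of "U ` {..n}"])
      fix W m \<sigma>
      assume "W \<in> U ` {..n}" and \<sigma>: "singular_simplex m (subtopology X W) \<sigma>"
      then obtain i where "i \<le> n" "W = V i" by (auto simp: V_def)
      then show "z m \<sigma> = 0" using z(3)[of i m \<sigma>] \<sigma> len by simp
    qed (use U cover in auto)
    \<comment> \<open>The coset of the coboundaries is the zero of the quotient ring.\<close>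
    then have "foldr (mult (image_ring X Y f)) xs \<one>\<^bsub>image_ring X Y f\<^esub> = coboundaries X"
      using z(2) coset_eq_coboundaries by simp
    then show False
      using nz by (simp add: image_ring_def cohomology_ring_def FactRing_def)
  qed
qed

theorem proposition2p32:
  fixes X :: "real \<Rightarrow> 'a topology" and f :: "real \<Rightarrow> real \<Rightarrow> 'a \<Rightarrow> 'a" and a b :: real
  assumes "persistent_space X f" and "a \<le> b"
  shows "persistent_cup TYPE('k::field) X f a b \<le> persistent_cat X f a b"
  unfolding persistent_cup_def persistent_cat_def
  by (rule cup_length_le_LS_cat) (use assms in \<open>simp add: persistent_space_def\<close>)

end
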